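(* Fix $p$ with $0<p<1$. Let $s=s_0s_1s_2\ldots$ be an infinite sequence of random letters $s_t\in\{1,2\}$, chosen independently with $\Pr\{s_t=1\}=1-p$ and $\Pr\{s_t=2\}=p$ for all $t\ge 0$. For $T\in\mathbb{N}$ let $\lambda(s,T)$ and $\mu(s,T)$ be the preperiod and period of $s$ modulo $T$ (defined in the context). Then, as $T\to\infty$ (with $p$ fixed), $$\mathbb{E}\,\lambda(s,T)=\frac{p}{(1-p)(1+p)^2}+O(p^T T),\qquad \mathbb{E}\,\mu(s,T)=\frac{T}{1+p}+O(p^T T),$$ $$\mathbb{D}\,\lambda(s,T)=\frac{p+p^3+p^4}{(1-p)^2(1+p)^4}+O(p^T T^2),\qquad \mathbb{D}\,\mu(s,T)=\frac{Tp(1-p)}{(1+p)^3}+O(p^T T^2),$$ where $\mathbb{E}$ denotes expectation and $\mathbb{D}$ denotes variance.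
   Context: Given an infinite word $s=s_0s_1\ldots$ over a finite alphabet $A\subset\{0,1,2,\ldots\}$ and $T\in\mathbb{N}$, consider the partial sums $P_t=s_0+s_1+\cdots+s_{t-1}\pmod T$ for $t\ge 0$ (so $P_0=0$). Equivalently, if $\varphi$ is a cyclic permutation of a set $\mathcal S$ with $|\mathcal S|=T$ and $S_{t+1}=\varphi^{s_t}(S_t)$, then $S_t=\varphi^{P_t}(S_0)$. The sequence $(P_t)$ is eventually periodic; $\lambda=\lambda(s,T)\in\{0,1,2,\ldots\}$ is its preperiod and $\mu=\mu(s,T)\in\mathbb{N}$ its period, i.e. $\lambda$ is the smallest index such that $P_\lambda=P_{\lambda+j}$ for some $j\ge1$, and $\mu$ is the smallest such $j$. Equivalently, $T$ divides $s_\lambda+\cdots+s_{\lambda+\mu-1}$, and $T$ divides none of the sums $s_t+s_{t+1}+\cdots+s_\tau$ with $0\le t\le\tau<\lambda+\mu-1$. For example, for $s=2212221\ldots$ one has $\lambda(s,8)=2$, $\mu(s,8)=5$. *)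

theory Defs
  imports "HOL-Probability.Probability" "HOL-Library.Landau_Symbols"
begin

definition partial_sum_mod :: "(nat \<Rightarrow> nat) \<Rightarrow> nat \<Rightarrow> nat \<Rightarrow> nat" where
  "partial_sum_mod s T t = (\<Sum>i<t. s i) mod T"

text \<open>\<open>l + m\<close> is the first time at which the sequence of partial sums modulo \<open>T\<close> takes
  a value it has already taken, and \<open>l\<close> is the time at which that value first occurred
  (lemma \<open>has_preperiod_period_iff\<close> below). Later values of the word play no role; the
  sequence of partial sums of an arbitrary word need not be eventually periodic.\<close>

definition has_preperiod_period :: "(nat \<Rightarrow> nat) \<Rightarrow> nat \<Rightarrow> nat \<Rightarrow> nat \<Rightarrow> bool" where
  "has_preperiod_period s T l m \<longleftrightarrow>
     m \<ge> 1 \<and> T dvd (\<Sum>i\<in>{l..l + m - 1}. s i) \<and>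
     (\<forall>t u. t \<le> u \<and> u < l + m - 1 \<longrightarrow> \<not> T dvd (\<Sum>i\<in>{t..u}. s i))"

text \<open>By \<open>has_preperiod_period_ex1\<close> these descriptions are proper for every \<open>T \<ge> 1\<close>.\<close>

definition preperiod :: "(nat \<Rightarrow> nat) \<Rightarrow> nat \<Rightarrow> nat" where
  "preperiod s T = (THE l. \<exists>m. has_preperiod_period s T l m)"

definition period :: "(nat \<Rightarrow> nat) \<Rightarrow> nat \<Rightarrow> nat" where
  "period s T = (THE m. \<exists>l. has_preperiod_period s T l m)"

lemma dvd_block_iff:
  assumes "a \<le> b"
  shows "T dvd (\<Sum>i\<in>{a..<b}. s i) \<longleftrightarrow> partial_sum_mod s T a = partial_sum_mod s T b"
proof -
  have "(\<Sum>i<b. s i) = (\<Sum>i<a. s i) + (\<Sum>i\<in>{a..<b}. s i)"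
    using assms by (simp add: lessThan_atLeast0 sum.atLeastLessThan_concat)
  then show ?thesis
    unfolding partial_sum_mod_def
    by (metis add.commute add_diff_cancel_left' le_add1 mod_eq_dvd_iff_nat)
qed

lemma has_preperiod_period_iff:
  "has_preperiod_period s T l m \<longleftrightarrow>
     m \<ge> 1 \<and> partial_sum_mod s T (l + m) = partial_sum_mod s T l \<and>
     inj_on (partial_sum_mod s T) {..<l + m}"
proof (cases "m \<ge> 1")
  case True
  have eq: "{l..l + m - 1} = {l..<l + m}"
    using True by auto
  have blk: "T dvd (\<Sum>i\<in>{t..u}. s i) \<longleftrightarrow> partial_sum_mod s T t = partial_sum_mod s T (Suc u)"
    if "t \<le> u" for t u
    using dvd_block_iff[of t "Suc u" T s] that by (simp add: atLeastLessThanSuc_atLeastAtMost)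
  have "(\<forall>t u. t \<le> u \<and> u < l + m - 1 \<longrightarrow> \<not> T dvd (\<Sum>i\<in>{t..u}. s i)) \<longleftrightarrow>
        inj_on (partial_sum_mod s T) {..<l + m}" (is "?A \<longleftrightarrow> ?B")
  proof
    assume A: ?A
    have "partial_sum_mod s T t \<noteq> partial_sum_mod s T v" if "t < v" "v < l + m" for t v
      using A[rule_format, of t "v - 1"] blk[of t "v - 1"] that by auto
    then show ?B
      by (intro linorder_inj_onI) auto
  next
    assume B: ?B
    show ?A
    proof (intro allI impI)
      fix t u assume tu: "t \<le> u \<and> u < l + m - 1"
      then have "Suc u < l + m" by linarith
      then show "\<not> T dvd (\<Sum>i\<in>{t..u}. s i)"
        using tu inj_onD[OF B, of t "Suc u"] blk[of t u] by auto
    qed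
  qed
  then show ?thesis
    unfolding has_preperiod_period_def using True eq dvd_block_iff[of l "l + m" T s] by auto
qed (simp add: has_preperiod_period_def)

lemma has_preperiod_period_unique:
  assumes "has_preperiod_period s T l m" "has_preperiod_period s T l' m'"
  shows "l = l' \<and> m = m'"
proof -
  have *: "\<not> l + m < l' + m'"
    if "has_preperiod_period s T l m" "has_preperiod_period s T l' m'" for l m l' m'
    using that inj_onD[of "partial_sum_mod s T" "{..<l' + m'}" "l + m" l]
    unfolding has_preperiod_period_iff by auto
  have sum: "l + m = l' + m'"
    using *[OF assms] *[OF assms(2,1)] by simp
  have "l = l'"
    using assms sum inj_onD[of "partial_sum_mod s T" "{..<l + m}" l l']
    unfolding has_preperiod_period_iff by auto
  with sum show ?thesis by simp
qed

lemma has_preperiod_period_bound: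
  assumes "has_preperiod_period s T l m" "T \<ge> 1"
  shows "l + m \<le> T"
proof -
  have "card (partial_sum_mod s T ` {..<l + m}) \<le> card {..<T}"
    using assms(2) by (intro card_mono) (auto simp: partial_sum_mod_def)
  then show ?thesis
    using assms(1) by (simp add: has_preperiod_period_iff card_image)
qed

lemma has_preperiod_period_ex1:
  assumes "T \<ge> 1"
  shows "\<exists>!(l, m). has_preperiod_period s T l m"
proof -
  let ?P = "partial_sum_mod s T"
  have "\<not> inj_on ?P {..<Suc T}"
  proof
    assume "inj_on ?P {..<Suc T}"
    moreover have "card (?P ` {..<Suc T}) \<le> card {..<T}"
      using assms by (intro card_mono) (auto simp: partial_sum_mod_def)
    ultimately show False by (simp add: card_image)
  qed
  define n where "n = (LEAST n. \<not> inj_on ?P {..<Suc n})"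
  have n: "\<not> inj_on ?P {..<Suc n}"
    unfolding n_def by (rule LeastI) fact
  have inj: "inj_on ?P {..<n}"
  proof (cases n)
    case (Suc k)
    then show ?thesis
      using not_less_Least[of k "\<lambda>n. \<not> inj_on ?P {..<Suc n}"] by (simp add: n_def)
  qed simp
  have "?P n \<in> ?P ` {..<n}"
    using n inj by (auto simp: lessThan_Suc)
  then obtain l where l: "l < n" "?P l = ?P n" by auto
  then have "has_preperiod_period s T l (n - l)"
    using inj by (simp add: has_preperiod_period_iff)
  then show ?thesis
    using has_preperiod_period_unique[of s T] by auto
qed

lemma preperiod_period_eqI:
  assumes "has_preperiod_period s T l m"
  shows "preperiod s T = l" "period s T = m"
  unfolding preperiod_def period_def
  using assms has_preperiod_period_unique[OF assms] by blast+

lemma has_preperiod_period: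
  "T \<ge> 1 \<Longrightarrow> has_preperiod_period s T (preperiod s T) (period s T)"
  using has_preperiod_period_ex1[of T s] preperiod_period_eqI[of s T] by auto

lemma preperiod_plus_period_le: "T \<ge> 1 \<Longrightarrow> preperiod s T + period s T \<le> T"
  using has_preperiod_period has_preperiod_period_bound by blast

lemma
  assumes s: "\<And>t. s t \<in> measurable M (count_space UNIV)" and T: "T \<ge> 1"
  shows measurable_preperiod:
      "(\<lambda>\<omega>. preperiod (\<lambda>t. s t \<omega>) T) \<in> measurable M (count_space UNIV)"
    and measurable_period:
      "(\<lambda>\<omega>. period (\<lambda>t. s t \<omega>) T) \<in> measurable M (count_space UNIV)"
proof -
  note [measurable] = s
  have "preperiod (\<lambda>t. s t \<omega>) T = l \<longleftrightarrow> (\<exists>m. has_preperiod_period (\<lambda>t. s t \<omega>) T l m)" for \<omega> l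
    using has_preperiod_period[OF T] preperiod_period_eqI(1) by blast
  then show "(\<lambda>\<omega>. preperiod (\<lambda>t. s t \<omega>) T) \<in> measurable M (count_space UNIV)"
    by (auto simp: measurable_count_space_eq2_countable vimage_def Int_def conj_commute
        has_preperiod_period_def)
  have "period (\<lambda>t. s t \<omega>) T = m \<longleftrightarrow> (\<exists>l. has_preperiod_period (\<lambda>t. s t \<omega>) T l m)" for \<omega> m
    using has_preperiod_period[OF T] preperiod_period_eqI(2) by blast
  then show "(\<lambda>\<omega>. period (\<lambda>t. s t \<omega>) T) \<in> measurable M (count_space UNIV)"
    by (auto simp: measurable_count_space_eq2_countable vimage_def Int_def conj_commute
        has_preperiod_period_def)
qed

lemma preperiod_period_example:
  assumes "map s [0..<7] = [2,2,1,2,2,2,1]"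
  shows "preperiod s 8 = 2" "period s 8 = 5"
proof -
  have "s 0 = 2" "s 1 = 2" "s 2 = 1" "s 3 = 2" "s 4 = 2" "s 5 = 2" "s 6 = 1"
    using assms by (simp_all add: upt_rec numeral_eq_Suc)
  then have "partial_sum_mod s 8 0 = 0" "partial_sum_mod s 8 1 = 2" "partial_sum_mod s 8 2 = 4"
    "partial_sum_mod s 8 3 = 5" "partial_sum_mod s 8 4 = 7" "partial_sum_mod s 8 5 = 1"
    "partial_sum_mod s 8 6 = 3" "partial_sum_mod s 8 7 = 4"
    by (simp_all add: partial_sum_mod_def lessThan_nat_numeral lessThan_Suc)
  moreover have "{..<2 + 5::nat} = {0,1,2,3,4,5,6}" by auto
  ultimately have "has_preperiod_period s 8 2 5"
    by (simp add: has_preperiod_period_iff)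
  then show "preperiod s 8 = 2" "period s 8 = 5"
    by (rule preperiod_period_eqI)+
qed

end

theory Submission
  imports Defs
begin

text \<open>A word over \<open>{1, 2}\<close> whose partial sums reach \<open>T\<close> has preperiod \<open>0\<close>. Otherwise the partial sums
  jump from \<open>T - 1\<close> to \<open>T + 1\<close>. The residues skipped in the first round are isolated, so the second
  round avoids the residues already visited only by continuing with letters \<open>2\<close> through
  \<open>1, 3, 5, \<dots>\<close>, and only as long as the word itself started with letters \<open>2\<close>. Hence the
  preperiod is \<open>l \<ge> 1\<close> exactly for the words starting with \<open>2\<^sup>l\<^sup>-\<^sup>1 1 w 2\<^sup>l\<close> or
  \<open>2\<^sup>l w 2\<^sup>l 1\<close>, where \<open>w\<close> leads to \<open>T - 1\<close>; the loop consists of everything after the first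
  \<open>l\<close> letters. (For odd \<open>T\<close> there is one degenerate word, \<open>2\<^sup>T\<close>.)

  Summed over \<open>w\<close>, the two families together say that for \<open>1 \<le> l \<le> T / 2\<close> the preperiod is \<open>l\<close>
  with probability \<open>(1 - p) p\<^sup>2\<^sup>l\<^sup>-\<^sup>1\<close>, and that given this the period is \<open>l\<close> plus
  the first time at which a fresh walk is at or above \<open>T - 2 l\<close>. The moments of first passage times
  satisfy a linear recurrence with characteristic roots \<open>1\<close> and \<open>- p\<close>, which gives closed forms.\<close>

section \<open>Moments of visiting and first passage times\<close>

text \<open>The probability that \<open>j\<close> independent letters sum to \<open>n\<close>:
  \<open>(j choose (n - j)) * p ^ (n - j) * (1 - p) ^ (2 * j - n)\<close> for
  \<open>j <= n <= 2 * j\<close>, and \<open>0\<close> otherwise. Separate cases for small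
  \<open>n\<close> avoid truncated subtraction.\<close>

fun sum_prob :: "real \<Rightarrow> nat \<Rightarrow> nat \<Rightarrow> real" where
  "sum_prob p 0 n = (if n = 0 then 1 else 0)"
| "sum_prob p (Suc j) 0 = 0"
| "sum_prob p (Suc j) (Suc 0) = (1 - p) * sum_prob p j 0"
| "sum_prob p (Suc j) (Suc (Suc n)) = (1 - p) * sum_prob p j (Suc n) + p * sum_prob p j n"

lemma sum_prob_eq_0: "n < j \<Longrightarrow> sum_prob p j n = 0"
  by (induction p j n rule: sum_prob.induct) auto

text \<open>For a walk with independent steps in \<open>{1, 2}\<close>: the mean of \<open>g\<close> at the time of visiting \<open>n\<close>,
  restricted to the event that \<open>n\<close> is visited.\<close>

definition hit_mean :: "real \<Rightarrow> (nat \<Rightarrow> real) \<Rightarrow> nat \<Rightarrow> real" where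
  "hit_mean p g n = (\<Sum>j\<le>n. g j * sum_prob p j n)"

lemma hit_mean_0: "hit_mean p g 0 = g 0"
  by (simp add: hit_mean_def)

lemma hit_mean_1: "hit_mean p g (Suc 0) = (1 - p) * g 1"
  by (simp add: hit_mean_def)

text \<open>Condition on the first step: the rest of the walk has to cover \<open>Suc n\<close> or
  \<open>n\<close>, and its clock is one behind, hence the shift inside \<open>g\<close>.\<close>

lemma hit_mean_rec:
  "hit_mean p g (Suc (Suc n)) =
     (1 - p) * hit_mean p (\<lambda>j. g (Suc j)) (Suc n) + p * hit_mean p (\<lambda>j. g (Suc j)) n"
proof -
  have "hit_mean p g (Suc (Suc n)) =
      (\<Sum>j\<le>Suc n. g (Suc j) * sum_prob p (Suc j) (Suc (Suc n)))"
    unfolding hit_mean_def by (subst sum.atMost_Suc_shift) simp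
  also have "\<dots> = (1 - p) * (\<Sum>j\<le>Suc n. g (Suc j) * sum_prob p j (Suc n))
      + p * (\<Sum>j\<le>Suc n. g (Suc j) * sum_prob p j n)"
    by (simp add: sum_distrib_left sum.distrib[symmetric] algebra_simps del: sum.atMost_Suc)
  also have "(\<Sum>j\<le>Suc n. g (Suc j) * sum_prob p j n) = (\<Sum>j\<le>n. g (Suc j) * sum_prob p j n)"
    by (simp add: sum_prob_eq_0)
  finally show ?thesis
    by (simp add: hit_mean_def)
qed

text \<open>The mean of \<open>g\<close> at the first time the walk is at or above \<open>n\<close>: either \<open>n\<close> is visited, or
  \<open>n - 1\<close> is visited and followed by a step \<open>2\<close>.\<close>

definition passage_mean :: "real \<Rightarrow> (nat \<Rightarrow> real) \<Rightarrow> nat \<Rightarrow> real" where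
  "passage_mean p g n =
     hit_mean p g n + (if n = 0 then 0 else p * hit_mean p (\<lambda>j. g (Suc j)) (n - 1))"

lemma passage_mean_0: "passage_mean p g 0 = g 0"
  by (simp add: passage_mean_def hit_mean_0)

lemma passage_mean_1: "passage_mean p g (Suc 0) = g 1"
  by (simp add: passage_mean_def hit_mean_0 hit_mean_1 algebra_simps)

lemma passage_mean_rec:
  "passage_mean p g (Suc (Suc n)) =
     (1 - p) * passage_mean p (\<lambda>j. g (Suc j)) (Suc n) + p * passage_mean p (\<lambda>j. g (Suc j)) n"
  by (cases n)
    (simp_all add: passage_mean_def hit_mean_0 hit_mean_1 hit_mean_rec algebra_simps)

section \<open>Closed forms for the first two moments\<close>

lemma passage_mean_const: "passage_mean p (\<lambda>j. a) n = a"
  by (induction n rule: induct_nat_012)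
    (simp_all add: passage_mean_0 passage_mean_1 passage_mean_rec algebra_simps)

text \<open>\<open>r\<close> is the reciprocal of the mean step \<open>1 + p\<close>; giving it by
  an equation keeps every identity polynomial. The induction varies \<open>a\<close> because each
  use of the recurrence raises this offset by one.\<close>

lemma passage_mean_linear:
  assumes "r * (1 + p) = 1"
  shows "passage_mean p (\<lambda>j. real j + a) n = a + r * n + p * r\<^sup>2 * (1 - (- p) ^ n)"
proof (induction n arbitrary: a rule: induct_nat_012)
  case 1
  show ?case using assms by (simp add: passage_mean_1) algebra
next
  case (ge2 n)
  \<comment> \<open>With \<open>(- p) ^ n\<close> treated as an unknown \<open>y\<close>, the claim
    becomes a polynomial identity modulo the equation for \<open>r\<close>.\<close>
  define y where "y = (- p) ^ n"
  have *: "(\<lambda>j. real (Suc j) + a) = (\<lambda>j. real j + (a + 1))" by auto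
  show ?case using assms
    unfolding passage_mean_rec * ge2 unfolding power_Suc y_def[symmetric] of_nat_Suc by algebra
qed (simp add: passage_mean_0)

text \<open>The linear moment enters as a source term resonant with both roots \<open>1\<close> and
  \<open>- p\<close>, so each polynomial coefficient gains one degree. The two occurrences of
  \<open>b\<close> cancel at \<open>n = 0\<close>; the value at \<open>n = 1\<close> fixes
  \<open>b\<close>.\<close>

lemma passage_mean_square:
  assumes "r * (1 + p) = 1"
  defines "b \<equiv> r ^ 4 * p * (4 * p - 1 - p\<^sup>2)"
  shows "passage_mean p (\<lambda>j. (real j + a)\<^sup>2) n =
    a\<^sup>2 + 2 * a * (r * n + p * r\<^sup>2 * (1 - (- p) ^ n))
     + r\<^sup>2 * (real n)\<^sup>2 + r ^ 3 * p * (3 - p) * n + b - (2 * p\<^sup>2 * r ^ 3 * n + b) * (- p) ^ n"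
proof (induction n arbitrary: a rule: induct_nat_012)
  case 1
  show ?case using assms(1) by (simp add: passage_mean_1 b_def) algebra
next
  case (ge2 n)
  define y where "y = (- p) ^ n"
  have *: "(\<lambda>j. (real (Suc j) + a)\<^sup>2) = (\<lambda>j. (real j + (a + 1))\<^sup>2)" by (auto simp: algebra_simps)
  show ?case using assms(1)
    unfolding passage_mean_rec * ge2 unfolding power_Suc y_def[symmetric] of_nat_Suc b_def by algebra
qed (simp add: passage_mean_0)

text \<open>The factor of \<open>a\<close>, \<open>r * (1 + p * (- p) ^ n)\<close>, is the
  probability that \<open>n\<close> is visited; it tends to \<open>r\<close>, as in the renewal
  theorem.\<close>

lemma hit_mean_linear:
  assumes "r * (1 + p) = 1"
  defines "b \<equiv> r ^ 3 * p * (1 - p)"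
  shows "hit_mean p (\<lambda>j. real j + a) n =
    a * r * (1 + p * (- p) ^ n) + r\<^sup>2 * n + b + (r\<^sup>2 * p\<^sup>2 * n - b) * (- p) ^ n"
proof (induction n arbitrary: a rule: induct_nat_012)
  case 0
  show ?case using assms(1) by (simp add: hit_mean_0 mult.assoc)
next
  case 1
  show ?case using assms(1) by (simp add: hit_mean_1 b_def) algebra
next
  case (ge2 n)
  define y where "y = (- p) ^ n"
  have *: "(\<lambda>j. real (Suc j) + a) = (\<lambda>j. real j + (a + 1))" by auto
  show ?case using assms(1)
    unfolding hit_mean_rec * ge2 unfolding power_Suc y_def[symmetric] of_nat_Suc b_def by algebra
qed

lemma hit_mean_square:
  assumes "r * (1 + p) = 1"
  defines "b \<equiv> r ^ 3 * p * (1 - p)"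
    and "c \<equiv> r ^ 5 * p * (1 - p) * (4 * p - 1 - p\<^sup>2)"
  shows "hit_mean p (\<lambda>j. (real j + a)\<^sup>2) n =
    a\<^sup>2 * r * (1 + p * (- p) ^ n)
     + 2 * a * (r\<^sup>2 * n + b + (r\<^sup>2 * p\<^sup>2 * n - b) * (- p) ^ n)
     + r ^ 3 * (real n)\<^sup>2 + 3 * r ^ 4 * p * (1 - p) * n + c
     + (r ^ 3 * p ^ 3 * (real n)\<^sup>2 - 3 * r ^ 4 * p\<^sup>2 * (1 - p) * n - c) * (- p) ^ n"
proof (induction n arbitrary: a rule: induct_nat_012)
  case 0
  show ?case using assms(1) by (simp add: hit_mean_0 mult.assoc)
next
  case 1
  show ?case using assms(1) by (simp add: hit_mean_1 b_def c_def) algebra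
next
  case (ge2 n)
  define y where "y = (- p) ^ n"
  have *: "(\<lambda>j. (real (Suc j) + a)\<^sup>2) = (\<lambda>j. (real j + (a + 1))\<^sup>2)" by (auto simp: algebra_simps)
  show ?case using assms(1)
    unfolding hit_mean_rec * ge2 unfolding power_Suc y_def[symmetric] of_nat_Suc b_def c_def by algebra
qed

section \<open>Classification of the first loop\<close>

text \<open>\<open>First l j\<close> stands for the words \<open>2\<^sup>l\<^sup>-\<^sup>1 1 w 2\<^sup>l\<close> and \<open>Second l j\<close> for \<open>2\<^sup>l w 2\<^sup>l 1\<close>, with
  \<open>j\<close> the length of \<open>w\<close>: the first letter \<open>1\<close> that ends the run of letters \<open>2\<close> occurs in the first
  or in the second round.\<close>

datatype loop_type = Direct nat | Wrap | First nat nat | Second nat nat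

fun loop_event :: "nat \<Rightarrow> loop_type \<Rightarrow> (nat \<Rightarrow> nat) \<Rightarrow> bool" where
  "loop_event T (Direct j) s \<longleftrightarrow> (\<Sum>i<j. s i) = T"
| "loop_event T Wrap s \<longleftrightarrow> odd T \<and> (\<forall>i<T. s i = 2)"
| "loop_event T (First l j) s \<longleftrightarrow> 1 \<le> l \<and> 2 * l \<le> T \<and>
     (\<forall>i<l - 1. s i = 2) \<and> s (l - 1) = 1 \<and>
     (\<Sum>i\<in>{l..<l + j}. s i) = T - 2 * l \<and> (\<forall>i\<in>{l + j..<l + j + l}. s i = 2)"
| "loop_event T (Second l j) s \<longleftrightarrow> 1 \<le> l \<and> 2 * l + 1 \<le> T \<and>
     (\<forall>i<l. s i = 2) \<and> (\<Sum>i\<in>{l..<l + j}. s i) = T - 1 - 2 * l \<and>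
     (\<forall>i\<in>{l + j..<l + j + l}. s i = 2) \<and> s (l + j + l) = 1"

fun loop_start :: "loop_type \<Rightarrow> nat" where
  "loop_start (Direct j) = 0"
| "loop_start Wrap = 0"
| "loop_start (First l j) = l"
| "loop_start (Second l j) = l"

fun loop_length :: "nat \<Rightarrow> loop_type \<Rightarrow> nat" where
  "loop_length T (Direct j) = j"
| "loop_length T Wrap = T"
| "loop_length T (First l j) = j + l"
| "loop_length T (Second l j) = Suc j + l"

lemma sum_const_2:
  assumes "\<And>i. a \<le> i \<Longrightarrow> i < b \<Longrightarrow> s i = 2"
  shows "(\<Sum>i\<in>{a..<b}. s i) = 2 * (b - a :: nat)"
proof -
  have "(\<Sum>i\<in>{a..<b}. s i) = (\<Sum>i\<in>{a..<b}. 2)"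
    using assms by (intro sum.cong) auto
  then show ?thesis by simp
qed

lemma sum_split_at:
  fixes s :: "nat \<Rightarrow> nat"
  shows "a \<le> b \<Longrightarrow> (\<Sum>i<b. s i) = (\<Sum>i<a. s i) + (\<Sum>i\<in>{a..<b}. s i)"
  by (simp add: lessThan_atLeast0 sum.atLeastLessThan_concat)

lemma partial_sum_strict_mono:
  fixes s :: "nat \<Rightarrow> nat"
  assumes "\<And>i. s i > 0"
  shows "strict_mono (\<lambda>t. \<Sum>i<t. s i)"
  by (rule strict_monoI_Suc) (simp add: assms)

text \<open>A word whose partial sums jump over \<open>T\<close>, from \<open>T - 1\<close> at time \<open>t\<close>, continues along
  \<open>T + 1, T + 3, \<dots>\<close> until it meets the residue of the \<open>l\<close>-th partial sum of the first round.\<close>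

lemma has_preperiod_period_jump:
  fixes s :: "nat \<Rightarrow> nat"
  defines "S \<equiv> \<lambda>t. \<Sum>i<t. s i"
  assumes pos: "\<And>i. s i > 0"
    and t: "S t = T - 1" "T \<ge> 1" "l \<le> t"
    and first: "\<And>i. i < l \<Longrightarrow> S i = 2 * i"
    and second: "\<And>i. t < i \<Longrightarrow> i < l + m \<Longrightarrow> S i = T + 2 * (i - t) - 1 \<and> 2 * (i - t) - 1 < S l"
    and "S (l + m) = S l + T" "l + m > t"
  shows "has_preperiod_period s T l m"
proof -
  have mono: "strict_mono S"
    unfolding S_def using pos by (rule partial_sum_strict_mono)
  have Sl: "S l \<le> T - 1"
    using t mono by (metis strict_mono_less_eq)
  have "m \<ge> 1"
    using assms(9) t by simp
  have ps: "partial_sum_mod s T i = S i mod T" for i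
    by (simp add: partial_sum_mod_def S_def)
  have le: "S i mod T = S i" if "i \<le> t" for i
    using that t mono strict_mono_less_eq[OF mono, of i t] by auto
  have gt: "S i mod T = 2 * (i - t) - 1" if "t < i" "i < l + m" for i
  proof -
    have "S i = T + (2 * (i - t) - 1)"
      using second[OF that] that by auto
    moreover have "2 * (i - t) - 1 < T"
      using second[OF that] Sl t by auto
    ultimately show ?thesis by simp
  qed
  \<comment> \<open>Within one round the residues increase. A clash between the rounds would force
    \<open>i < l\<close>, where the first-round sums are even while second-round residues are
    odd.\<close>
  have "S i mod T \<noteq> S j mod T" if "i < j" "j < l + m" for i j
  proof (cases "j \<le> t")
    case True
    then show ?thesis
      using le[of i] le[of j] that strict_mono_eq[OF mono] by auto
  next
    case False
    then have j: "S j mod T = 2 * (j - t) - 1" "2 * (j - t) - 1 < S l"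
      using gt second that by auto
    show ?thesis
    proof (cases "i \<le> t")
      case True
      show ?thesis
      proof
        assume "S i mod T = S j mod T"
        then have eq: "S i = 2 * (j - t) - 1"
          using le[OF True] j by simp
        then have "i < l"
          using j(2) strict_mono_less[OF mono, of i l] by simp
        then have "2 * i = 2 * (j - t) - 1"
          using first eq by simp
        then show False
          using False by presburger
      qed
    next
      case False
      then show ?thesis
        using gt[of i] j(1) that by auto
    qed
  qed
  then have "inj_on (partial_sum_mod s T) {..<l + m}"
    by (intro linorder_inj_onI) (auto simp: ps)
  then show ?thesis
    using \<open>m \<ge> 1\<close> assms(8) by (simp add: has_preperiod_period_iff ps)
qed

text \<open>For \<open>Direct\<close> the sums stay below \<open>T\<close> until they hit it; for
  \<open>Wrap\<close> the number \<open>2\<close> is invertible modulo the odd \<open>T\<close>. The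
  other two types are instances of the jump lemma with \<open>t = l + j\<close>.\<close>

lemma loop_event_has_preperiod_period:
  assumes "loop_event T c s" and T: "T \<ge> 1" and pos: "\<And>i. s i > 0"
  shows "has_preperiod_period s T (loop_start c) (loop_length T c)"
proof -
  define S where "S = (\<lambda>t. \<Sum>i<t. s i)"
  have mono: "strict_mono S"
    unfolding S_def using pos by (rule partial_sum_strict_mono)
  have S_split: "S b = S a + (\<Sum>i\<in>{a..<b}. s i)" if "a \<le> b" for a b
    unfolding S_def using that by (rule sum_split_at)
  have S0: "S 0 = 0" and S_Suc: "S (Suc i) = S i + s i" for i
    by (simp_all add: S_def)
  have "sum s {..<t} = S t" for t
    by (simp add: S_def)
  note jump = has_preperiod_period_jump[where s = s, unfolded this, OF pos]
  have ps: "partial_sum_mod s T i = S i mod T" for i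
    by (simp add: partial_sum_mod_def S_def)
  show ?thesis
  proof (cases c)
    case (Direct j)
    then have Sj: "S j = T"
      using assms by (simp add: S_def)
    then have "S i mod T = S i" if "i < j" for i
      using that mono by (simp add: strict_mono_less flip: Sj)
    moreover have "inj_on S {..<j}"
      using strict_mono_eq[OF mono] by (auto intro: inj_onI)
    ultimately have "inj_on (partial_sum_mod s T) {..<j}"
      by (simp add: inj_on_def ps)
    moreover have "j \<noteq> 0"
      using Sj S0 T by (intro notI) auto
    ultimately show ?thesis
      using Direct Sj S0 by (simp add: has_preperiod_period_iff ps)
  next
    case Wrap
    then have odd: "odd T" and two: "\<And>i. i < T \<Longrightarrow> s i = 2"
      using assms by auto
    have S: "S i = 2 * i" if "i \<le> T" for i
      using S_split[of 0 i] sum_const_2[of 0 i s] two that S0 by auto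
    have "S i mod T \<noteq> S j mod T" if "i < j" "j < T" for i j
    proof
      assume "S i mod T = S j mod T"
      then have "T dvd 2 * j - 2 * i"
        using S[of i] S[of j] that by (metis le_add2 less_imp_le_nat less_trans mod_eq_dvd_iff_nat mult_le_mono2)
      then have "T dvd 2 * (j - i)"
        by (simp add: diff_mult_distrib2)
      then have "T dvd j - i"
        using odd by (metis coprime_commute coprime_dvd_mult_right_iff coprime_right_2_iff_odd)
      then show False
        using that by (auto dest: dvd_imp_le)
    qed
    then have "inj_on (partial_sum_mod s T) {..<T}"
      by (intro linorder_inj_onI) (auto simp: ps)
    then show ?thesis
      using Wrap S[of T] S0 T by (simp add: has_preperiod_period_iff ps)
  next
    case (First l j)
    then have l: "1 \<le> l" "2 * l \<le> T" "s (l - 1) = 1"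
      and two: "\<And>i. i < l - 1 \<Longrightarrow> s i = 2" "\<And>i. l + j \<le> i \<Longrightarrow> i < l + j + l \<Longrightarrow> s i = 2"
      and w: "(\<Sum>i\<in>{l..<l + j}. s i) = T - 2 * l"
      using assms by auto
    have first: "S i = 2 * i" if "i < l" for i
      using S_split[of 0 i] sum_const_2[of 0 i s] two that S0 by auto
    have Sl: "S l = 2 * l - 1"
      using first[of "l - 1"] S_Suc[of "l - 1"] l by simp
    have St: "S (l + j) = T - 1"
      using S_split[of l "l + j"] w Sl l by simp
    have snd: "S i = T + 2 * (i - (l + j)) - 1" if "l + j \<le> i" "i \<le> l + j + l" for i
      using S_split[of "l + j" i] sum_const_2[of "l + j" i s] two that St T by auto
    have "has_preperiod_period s T l (j + l)"
      using snd[of "l + j + l"] l Sl St T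
      by (intro jump[of "l + j"]) (auto simp: first snd ac_simps)
    then show ?thesis using First by simp
  next
    case (Second l j)
    then have l: "1 \<le> l" "2 * l + 1 \<le> T" "s (l + j + l) = 1"
      and two: "\<And>i. i < l \<Longrightarrow> s i = 2" "\<And>i. l + j \<le> i \<Longrightarrow> i < l + j + l \<Longrightarrow> s i = 2"
      and w: "(\<Sum>i\<in>{l..<l + j}. s i) = T - 1 - 2 * l"
      using assms by auto
    have first: "S i = 2 * i" if "i \<le> l" for i
      using S_split[of 0 i] sum_const_2[of 0 i s] two that S0 by auto
    have St: "S (l + j) = T - 1"
      using S_split[of l "l + j"] w first[of l] l by simp
    have snd: "S i = T + 2 * (i - (l + j)) - 1" if "l + j \<le> i" "i \<le> l + j + l" for i
      using S_split[of "l + j" i] sum_const_2[of "l + j" i s] two that St T by auto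
    \<comment> \<open>The final letter \<open>1\<close> takes the sum from
      \<open>T + 2 * l - 1\<close> to \<open>T + 2 * l\<close>, which is \<open>T + S l\<close>; in
      the previous case the loop already closes at \<open>T + 2 * l - 1\<close>.\<close>
    have "has_preperiod_period s T l (Suc j + l)"
      using snd[of "l + j + l"] S_Suc[of "l + j + l"] first[of l] l St T
      by (intro jump[of "l + j"]) (auto simp: first snd ac_simps)
    then show ?thesis using Second by simp
  qed
qed

text \<open>The word determines \<open>loop_start\<close> and \<open>loop_length\<close>. The
  remaining ambiguity is settled by letter \<open>l - 1\<close>, which is \<open>1\<close> for
  \<open>First\<close> and \<open>2\<close> for \<open>Second\<close>, and by the sum of the first
  \<open>T\<close> letters, which separates \<open>Direct T\<close> from
  \<open>Wrap\<close>.\<close>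

lemma loop_event_unique:
  assumes c: "loop_event T c s" "loop_event T c' s" and "T \<ge> 1" and "\<And>i. s i > 0"
  shows "c = c'"
proof -
  have eq: "loop_start c = loop_start c'" "loop_length T c = loop_length T c'"
    using loop_event_has_preperiod_period[OF c(1)] loop_event_has_preperiod_period[OF c(2)]
      has_preperiod_period_unique assms(3,4) by blast+
  have two: "(\<Sum>i<T. s i) \<noteq> T" if "\<forall>i<T. s i = 2"
    using sum_const_2[of 0 T s] that \<open>T \<ge> 1\<close> by (simp add: lessThan_atLeast0)
  show ?thesis
    using eq c two by (cases c; cases c') auto
qed

text \<open>Compare the start of the word with the letters following the jump over \<open>T\<close>:
  the first position at which either has a letter \<open>1\<close> is \<open>l - 1\<close>, and the
  place where it occurs gives the family, the start of the word having priority.\<close>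

lemma loop_event_ex:
  fixes s :: "nat \<Rightarrow> nat"
  assumes T: "T \<ge> 1" and s: "\<And>i. s i \<in> {1, 2}"
  shows "\<exists>c. loop_event T c s"
proof -
  define S where "S = (\<lambda>t. \<Sum>i<t. s i)"
  have pos: "s i > 0" for i
    using s[of i] by auto
  have mono: "strict_mono S"
    unfolding S_def using pos by (rule partial_sum_strict_mono)
  have S_le: "a \<le> b" if "S a \<le> S b" for a b
    using that strict_mono_less_eq[OF mono] by simp
  have S_split: "S b = S a + (\<Sum>i\<in>{a..<b}. s i)" if "a \<le> b" for a b
    unfolding S_def using that by (rule sum_split_at)
  have S0: "S 0 = 0" and S_Suc: "S (Suc i) = S i + s i" for i
    by (simp_all add: S_def)
  show ?thesis
  proof (cases "\<exists>j. S j = T")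
    case True
    then obtain j where "S j = T" by auto
    then show ?thesis by (intro exI[of _ "Direct j"]) (simp add: S_def)
  next
    case no_hit: False
    \<comment> \<open>The last time before the sums exceed \<open>T\<close>; as \<open>T\<close>
      itself is missed, the walk is then at \<open>T - 1\<close> and its next letter is
      \<open>2\<close>.\<close>
    define t where "t = (LEAST t. S (Suc t) > T)"
    have "S (Suc T) > T"
      using strict_mono_imp_increasing[OF mono, of "Suc T"] by simp
    then have gt: "S (Suc t) > T"
      unfolding t_def by (rule LeastI)
    have "S t \<le> T"
    proof (cases t)
      case (Suc k)
      then show ?thesis
        using not_less_Least[of k "\<lambda>t. S (Suc t) > T"] by (simp add: t_def)
    qed (simp add: S0)
    then have "S t < T"
      using no_hit by (simp add: order_less_le)
    then have St: "S t = T - 1" and st: "s t = 2"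
      using gt S_Suc[of t] s[of t] by auto
    let ?P = "\<lambda>k. s k = 1 \<or> s (Suc t + k) = 1"
    show ?thesis
    proof (cases "\<exists>k. ?P k \<and> 2 * Suc k \<le> T")
      case True
      define k where "k = (LEAST k. ?P k)"
      have k: "?P k" "2 * Suc k \<le> T"
        using True LeastI[of ?P] Least_le[of ?P] unfolding k_def by fastforce+
      have min: "s i = 2 \<and> s (Suc t + i) = 2" if "i < k" for i
        using that not_less_Least[of i ?P] s[of i] s[of "Suc t + i"] unfolding k_def by auto
      \<comment> \<open>The letter at \<open>t\<close> is the jump itself; with the \<open>k\<close>
        letters behind it, it forms the required run of \<open>l = Suc k\<close> letters
        \<open>2\<close>.\<close>
      have after: "s i = 2" if "t \<le> i" "i < t + Suc k" for i
      proof (cases "i = t")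
        case False
        then show ?thesis using min[of "i - Suc t"] that by auto
      qed (simp add: st)
      have Sk: "S k = 2 * k"
        using S_split[of 0 k] sum_const_2[of 0 k s] min S0 by auto
      show ?thesis
      proof (cases "s k = 1")
        case True
        then have Sk1: "S (Suc k) = 2 * k + 1"
          by (simp add: S_Suc Sk)
        then have "Suc k \<le> t"
          using k(2) St by (intro S_le[of "Suc k" t]) simp
        moreover from this have "(\<Sum>i\<in>{Suc k..<t}. s i) = T - 2 * Suc k"
          using S_split[of "Suc k" t] St Sk1 by simp
        ultimately have "loop_event T (First (Suc k) (t - Suc k)) s"
          using k True min after by auto
        then show ?thesis ..
      next
        case False
        then have sk: "s k = 2" "s (Suc t + k) = 1"
          using k s[of k] by auto
        then have Sk1: "S (Suc k) = 2 * k + 2"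
          by (simp add: S_Suc Sk)
        \<comment> \<open>Equality \<open>2 * Suc k = T\<close> would be a hit of \<open>T\<close>,
          so the bound is strict, as \<open>Second\<close> demands.\<close>
        moreover have "S (Suc k) \<noteq> T"
          using no_hit by blast
        ultimately have T': "2 * Suc k + 1 \<le> T"
          using k(2) by simp
        then have "Suc k \<le> t"
          using Sk1 St by (intro S_le[of "Suc k" t]) simp
        moreover from this have "(\<Sum>i\<in>{Suc k..<t}. s i) = T - 1 - 2 * Suc k"
          using S_split[of "Suc k" t] St Sk1 by simp
        ultimately have "loop_event T (Second (Suc k) (t - Suc k)) s"
          using T' sk min after by (auto simp: less_Suc_eq)
        then show ?thesis ..
      qed
    next
      case False
      \<comment> \<open>Both runs of letters \<open>2\<close> now reach half of \<open>T\<close>. An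
        even \<open>T\<close> would be hit; for odd \<open>T\<close> this gives
        \<open>t = T div 2\<close>, and the two runs with the jump letter between them cover all
        positions below \<open>T\<close>.\<close>
      then have two: "s k = 2" "s (Suc t + k) = 2" if "2 * Suc k \<le> T" for k
        using that s[of k] s[of "Suc t + k"] by auto
      have S_half: "S (T div 2) = 2 * (T div 2)"
        using S_split[of 0 "T div 2"] sum_const_2[of 0 "T div 2" s] two(1) S0 by auto
      have "odd T"
        using no_hit S_half by (metis dvd_mult_div_cancel)
      then have "S (T div 2) = S t"
        using S_half St by (simp add: odd_two_times_div_two_nat)
      then have t: "t = T div 2"
        using strict_mono_eq[OF mono] by metis
      have "s i = 2" if "i < T" for i
      proof -
        consider "i < t" | "i = t" | "i > t" by linarith
        then show ?thesis
        proof cases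
          case 1
          then show ?thesis using two(1)[of i] t by auto
        next
          case 3
          then show ?thesis using two(2)[of "i - Suc t"] t that \<open>odd T\<close>
            by (auto elim!: oddE)
        qed (simp add: st)
      qed
      then have "loop_event T Wrap s"
        using \<open>odd T\<close> by simp
      then show ?thesis ..
    qed
  qed
qed

section \<open>The joint law of preperiod and period\<close>

locale letter_process = prob_space M for M :: "'a measure" +
  fixes s :: "nat \<Rightarrow> 'a \<Rightarrow> nat" and p :: real
  assumes indep: "indep_vars (\<lambda>_. count_space UNIV) s UNIV"
    and letters: "\<And>t \<omega>. \<omega> \<in> space M \<Longrightarrow> s t \<omega> \<in> {1, 2}"
    and p_pos: "0 < p" and p_less_1: "p < 1"
    and prob_1: "\<And>t. prob {\<omega> \<in> space M. s t \<omega> = 1} = 1 - p"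
    and prob_2: "\<And>t. prob {\<omega> \<in> space M. s t \<omega> = 2} = p"
begin

lemma measurable_s [measurable]: "s t \<in> measurable M (count_space UNIV)"
  using indep by (auto simp: indep_vars_def)

text \<open>The mixed event lets one induction on \<open>B\<close> serve all loop types: an index
  moves from \<open>B\<close> into the prescribed set \<open>A\<close>, with either letter as its
  value, until independence alone decides. Hence \<open>A\<close> and \<open>w\<close> vary in the
  induction.\<close>

lemma prob_letters_sum:
  assumes "finite A" "finite B" "A \<inter> B = {}" "\<And>i. i \<in> A \<Longrightarrow> w i \<in> {1, 2}"
  shows "prob {\<omega> \<in> space M. (\<forall>i\<in>A. s i \<omega> = w i) \<and> (\<Sum>i\<in>B. s i \<omega>) = n} =
    (\<Prod>i\<in>A. if w i = 1 then 1 - p else p) * sum_prob p (card B) n"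
  using assms(2,1,3,4)
proof (induction B arbitrary: A w n rule: finite_induct)
  case empty
  have "prob {\<omega> \<in> space M. \<forall>i\<in>A. s i \<omega> = w i} = (\<Prod>i\<in>A. if w i = 1 then 1 - p else p)"
  proof (cases "A = {}")
    case True
    then show ?thesis by (simp add: prob_space)
  next
    case False
    have "prob (\<Inter>i\<in>A. s i -` {w i} \<inter> space M) = (\<Prod>i\<in>A. prob (s i -` {w i} \<inter> space M))"
      using empty False by (intro indep_varsD[OF indep]) auto
    also have "(\<Inter>i\<in>A. s i -` {w i} \<inter> space M) = {\<omega> \<in> space M. \<forall>i\<in>A. s i \<omega> = w i}"
      using False by auto
    also have "(\<Prod>i\<in>A. prob (s i -` {w i} \<inter> space M)) =
        (\<Prod>i\<in>A. if w i = 1 then 1 - p else p)"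
      using empty(3) prob_1 prob_2
      by (intro prod.cong refl) (fastforce simp: vimage_def Int_def conj_commute)
    finally show ?thesis .
  qed
  then show ?case by simp
next
  case (insert b B)
  define E where "E x m = {\<omega> \<in> space M.
    (\<forall>i\<in>insert b A. s i \<omega> = (w(b := x)) i) \<and> (\<Sum>i\<in>B. s i \<omega>) = m}" for x m
  have b: "b \<notin> A" "b \<notin> B"
    using insert by auto
  have [measurable]: "E x m \<in> sets M" for x m
    unfolding E_def using insert by measurable
  have E: "prob (E x m) = (if x = 1 then 1 - p else p) *
      (\<Prod>i\<in>A. if w i = 1 then 1 - p else p) * sum_prob p (card B) m" if "x \<in> {1, 2}" for x m
  proof -
    have "(\<Prod>i\<in>A. if (w(b := x)) i = 1 then 1 - p else p) =
        (\<Prod>i\<in>A. if w i = 1 then 1 - p else p)"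
      using b by (intro prod.cong) auto
    moreover have "(w(b := x)) i \<in> {1, 2}" if "i \<in> insert b A" for i
      using that \<open>x \<in> {1, 2}\<close> insert.prems(3)[of i] by auto
    ultimately show ?thesis
      unfolding E_def using insert.prems(1,2) b
      by (subst insert.IH) auto
  qed
  \<comment> \<open>The guards on \<open>n\<close> discard truncated subtractions: a letter
    \<open>x\<close> at \<open>b\<close> requires \<open>n\<close> to be at least
    \<open>x\<close>.\<close>
  have decomp: "{\<omega> \<in> space M. (\<forall>i\<in>A. s i \<omega> = w i) \<and> (\<Sum>i\<in>insert b B. s i \<omega>) = n} =
      (if n \<ge> 1 then E 1 (n - 1) else {}) \<union> (if n \<ge> 2 then E 2 (n - 2) else {})"
    (is "?E = ?R")
  proof (rule set_eqI)
    fix \<omega>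
    have w: "(\<forall>i\<in>insert b A. s i \<omega> = (w(b := x)) i) \<longleftrightarrow> s b \<omega> = x \<and> (\<forall>i\<in>A. s i \<omega> = w i)" for x
      using b by auto
    have "s b \<omega> = 1 \<or> s b \<omega> = 2" if "\<omega> \<in> space M"
      using letters[OF that, of b] by blast
    then show "\<omega> \<in> ?E \<longleftrightarrow> \<omega> \<in> ?R"
      unfolding E_def w using insert(1) b by (auto simp del: sum_eq_0_iff)
  qed
  have "E 1 m \<inter> E 2 k = {}" for m k
    by (auto simp: E_def)
  then have "prob ?E = (if n \<ge> 1 then prob (E 1 (n - 1)) else 0) + (if n \<ge> 2 then prob (E 2 (n - 2)) else 0)"
    unfolding decomp by (subst finite_measure_Union) auto
  also have "\<dots> = (\<Prod>i\<in>A. if w i = 1 then 1 - p else p) * sum_prob p (Suc (card B)) n"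
  proof -
    consider "n = 0" | "n = Suc 0" | m where "n = Suc (Suc m)"
      by (metis not0_implies_Suc)
    then show ?thesis
      by cases (simp_all add: E algebra_simps)
  qed
  finally show ?case
    using insert(1) b by simp
qed

lemma prob_loop_event_Direct:
  "prob {\<omega> \<in> space M. loop_event T (Direct j) (\<lambda>t. s t \<omega>)} = sum_prob p j T"
  using prob_letters_sum[of "{}" "{..<j}" _ T] by simp

lemma prob_loop_event_Wrap:
  assumes "odd T"
  shows "prob {\<omega> \<in> space M. loop_event T Wrap (\<lambda>t. s t \<omega>)} = p ^ T"
  using prob_letters_sum[of "{..<T}" "{}" "\<lambda>_. 2" 0] assms by (simp add: Ball_def)

lemma prob_loop_event_First:
  assumes l: "1 \<le> l" "2 * l \<le> T"
  shows "prob {\<omega> \<in> space M. loop_event T (First l j) (\<lambda>t. s t \<omega>)} =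
    (1 - p) * p ^ (2 * l - 1) * sum_prob p j (T - 2 * l)"
proof -
  \<comment> \<open>\<open>A\<close> holds the \<open>2 * l - 1\<close> prescribed letters
    \<open>2\<close>; the prescribed \<open>1\<close> at \<open>l - 1\<close> is added separately,
    and the free word of length \<open>j\<close> lies between the two blocks.\<close>
  define A where "A = {..<l - 1} \<union> {l + j..<l + j + l}"
  have card: "card A = 2 * l - 1"
    unfolding A_def using l by (subst card_Un_disjoint) auto
  have A: "finite A" "l - 1 \<notin> A" "insert (l - 1) A \<inter> {l..<l + j} = {}"
    unfolding A_def using l by auto
  have *: "(\<forall>i\<in>insert (l - 1) A. x i = (if i = l - 1 then 1 else 2)) \<longleftrightarrow>
      x (l - 1) = 1 \<and> (\<forall>i\<in>A. x i = 2)" for x :: "nat \<Rightarrow> nat"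
    using A(2) by force
  have event: "loop_event T (First l j) x \<longleftrightarrow> (\<forall>i\<in>insert (l - 1) A. x i = (if i = l - 1 then 1 else 2)) \<and>
      (\<Sum>i\<in>{l..<l + j}. x i) = T - 2 * l" for x
    unfolding * using l by (auto simp: A_def ball_Un)
  have prod: "(\<Prod>i\<in>A. if (if i = l - 1 then 1 else 2 :: nat) = 1 then 1 - p else p) = (\<Prod>i\<in>A. p)"
    using A by (intro prod.cong) auto
  show ?thesis
    unfolding event
    by (subst prob_letters_sum) (use A card in \<open>auto simp: prod[simplified]\<close>)
qed

lemma prob_loop_event_Second:
  assumes l: "1 \<le> l" "2 * l + 1 \<le> T"
  shows "prob {\<omega> \<in> space M. loop_event T (Second l j) (\<lambda>t. s t \<omega>)} =
    (1 - p) * p ^ (2 * l) * sum_prob p j (T - 1 - 2 * l)"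
proof -
  define A where "A = {..<l} \<union> {l + j..<l + j + l}"
  have card: "card A = 2 * l"
    unfolding A_def using l by (subst card_Un_disjoint) auto
  have A: "finite A" "l + j + l \<notin> A" "insert (l + j + l) A \<inter> {l..<l + j} = {}"
    unfolding A_def using l by auto
  have *: "(\<forall>i\<in>insert (l + j + l) A. x i = (if i = l + j + l then 1 else 2)) \<longleftrightarrow>
      x (l + j + l) = 1 \<and> (\<forall>i\<in>A. x i = 2)" for x :: "nat \<Rightarrow> nat"
    using A(2) by force
  have event: "loop_event T (Second l j) x \<longleftrightarrow>
      (\<forall>i\<in>insert (l + j + l) A. x i = (if i = l + j + l then 1 else 2)) \<and>
      (\<Sum>i\<in>{l..<l + j}. x i) = T - 1 - 2 * l" for x
    unfolding * using l by (auto simp: A_def ball_Un)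
  have prod: "(\<Prod>i\<in>A. if (if i = l + j + l then 1 else 2 :: nat) = 1 then 1 - p else p) =
      (\<Prod>i\<in>A. p)"
    using A by (intro prod.cong) auto
  show ?thesis
    unfolding event
    by (subst prob_letters_sum) (use A card in \<open>auto simp: prod[simplified]\<close>)
qed

section \<open>Expectations as finite sums over loop types\<close>

lemma expectation_partition:
  fixes g :: "'c \<Rightarrow> real"
  assumes I: "finite I" and A: "\<And>c. c \<in> I \<Longrightarrow> A c \<in> events"
    and ex1: "\<And>\<omega>. \<omega> \<in> space M \<Longrightarrow> \<exists>!c. c \<in> I \<and> \<omega> \<in> A c"
    and X: "\<And>c \<omega>. \<omega> \<in> A c \<Longrightarrow> X \<omega> = g c"
  shows "expectation X = (\<Sum>c\<in>I. g c * prob (A c))"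
proof -
  have "X \<omega> = (\<Sum>c\<in>I. g c * indicator (A c) \<omega>)" if \<omega>: "\<omega> \<in> space M" for \<omega>
  proof -
    obtain c where c: "c \<in> I" "\<omega> \<in> A c" and uniq: "\<And>c'. c' \<in> I \<Longrightarrow> \<omega> \<in> A c' \<Longrightarrow> c' = c"
      using ex1[OF \<omega>] by blast
    have "(\<Sum>c'\<in>I. g c' * indicator (A c') \<omega>) = (\<Sum>c'\<in>I. if c' = c then g c else 0)"
    proof (intro sum.cong refl)
      fix c' assume "c' \<in> I"
      then have "\<omega> \<in> A c' \<longleftrightarrow> c' = c"
        using c(2) uniq by blast
      then show "g c' * indicator (A c') \<omega> = (if c' = c then g c else 0)"
        by (simp add: indicator_def)
    qed
    also have "\<dots> = X \<omega>"
      unfolding X[OF c(2)] sum.delta[OF I] using c(1) by simp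
    finally show ?thesis ..
  qed
  then have "expectation X = expectation (\<lambda>\<omega>. \<Sum>c\<in>I. g c * indicator (A c) \<omega>)"
    by (intro Bochner_Integration.integral_cong) auto
  also have "\<dots> = (\<Sum>c\<in>I. expectation (\<lambda>\<omega>. g c * indicator (A c) \<omega>))"
    using A by (intro Bochner_Integration.integral_sum integrable_mult_right
        integrable_real_indicator) (auto simp: less_top[symmetric])
  also have "\<dots> = (\<Sum>c\<in>I. g c * prob (A c))"
    using A by (intro sum.cong) auto
  finally show ?thesis .
qed

end

text \<open>Positive letters make a word no longer than its sum; this bounds \<open>j\<close> and
  makes the partition finite. The condition \<open>2 * l < T\<close> keeps
  \<open>T - 1 - 2 * l\<close> from being truncated.\<close>

definition loop_types :: "nat \<Rightarrow> loop_type set" where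
  "loop_types T = Direct ` {..T} \<union> (if odd T then {Wrap} else {}) \<union>
     (\<lambda>(l, j). First l j) ` (SIGMA l:{1..T div 2}. {..T - 2 * l}) \<union>
     (\<lambda>(l, j). Second l j) ` (SIGMA l:{l \<in> {1..T div 2}. 2 * l < T}. {..T - 1 - 2 * l})"

lemma finite_loop_types: "finite (loop_types T)"
  by (simp add: loop_types_def)

lemma loop_event_in_loop_types:
  assumes "loop_event T c s" and pos: "\<And>i. s i > 0"
  shows "c \<in> loop_types T"
proof -
  have le: "b - a \<le> (\<Sum>i\<in>{a..<b}. s i)" for a b
    using sum_mono[of "{a..<b}" "\<lambda>_. 1" s] pos by (simp add: Suc_leI)
  show ?thesis
  proof (cases c)
    case (Direct j)
    then show ?thesis
      using assms(1) le[of j 0] by (auto simp: loop_types_def lessThan_atLeast0)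
  next
    case Wrap
    then show ?thesis
      using assms(1) by (simp add: loop_types_def)
  next
    case (First l j)
    then have "(l, j) \<in> (SIGMA l:{1..T div 2}. {..T - 2 * l})"
      using assms(1) le[of "l + j" l] by auto
    then show ?thesis
      using First by (force simp: loop_types_def)
  next
    case (Second l j)
    then have "(l, j) \<in> (SIGMA l:{l \<in> {1..T div 2}. 2 * l < T}. {..T - 1 - 2 * l})"
      using assms(1) le[of "l + j" l] by auto
    then show ?thesis
      using Second by (force simp: loop_types_def)
  qed
qed

lemma sum_loop_types:
  fixes g :: "loop_type \<Rightarrow> real"
  shows "(\<Sum>c\<in>loop_types T. g c) = (\<Sum>j\<le>T. g (Direct j)) + (if odd T then g Wrap else 0) +
    (\<Sum>l = 1..T div 2. (\<Sum>j\<le>T - 2 * l. g (First l j)) +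
      (if 2 * l < T then \<Sum>j\<le>T - 1 - 2 * l. g (Second l j) else 0))"
proof -
  let ?F = "SIGMA l:{1..T div 2}. {..T - 2 * l}"
  let ?S = "SIGMA l:{l \<in> {1..T div 2}. 2 * l < T}. {..T - 1 - 2 * l}"
  have "(\<Sum>c\<in>loop_types T. g c) = (\<Sum>c\<in>Direct ` {..T}. g c) + (if odd T then g Wrap else 0) +
      (\<Sum>c\<in>(\<lambda>(l, j). First l j) ` ?F. g c) + (\<Sum>c\<in>(\<lambda>(l, j). Second l j) ` ?S. g c)"
    unfolding loop_types_def
    by (subst sum.union_disjoint; (subst sum.union_disjoint)?; (subst sum.union_disjoint)?) auto
  also have "(\<Sum>c\<in>Direct ` {..T}. g c) = (\<Sum>j\<le>T. g (Direct j))"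
    by (subst sum.reindex) (auto simp: inj_on_def)
  also have "(\<Sum>c\<in>(\<lambda>(l, j). First l j) ` ?F. g c) =
      (\<Sum>l = 1..T div 2. \<Sum>j\<le>T - 2 * l. g (First l j))"
    by (subst sum.reindex) (auto simp: inj_on_def sum.Sigma intro!: sum.cong)
  also have "(\<Sum>c\<in>(\<lambda>(l, j). Second l j) ` ?S. g c) =
      (\<Sum>l\<in>{l \<in> {1..T div 2}. 2 * l < T}. \<Sum>j\<le>T - 1 - 2 * l. g (Second l j))"
    by (subst sum.reindex) (auto simp: inj_on_def sum.Sigma intro!: sum.cong)
  also have "\<dots> = (\<Sum>l = 1..T div 2.
      if 2 * l < T then \<Sum>j\<le>T - 1 - 2 * l. g (Second l j) else 0)"
    by (subst sum.inter_filter) auto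
  finally show ?thesis
    by (simp add: sum.distrib)
qed

context letter_process
begin

text \<open>The types with preperiod \<open>0\<close> give the first two terms. For fixed
  \<open>l >= 1\<close>, \<open>First\<close> and \<open>Second\<close> correspond to the two ways
  in which a fresh walk passes \<open>T - 2 * l\<close>: by visiting it, or by a step
  \<open>2\<close> from the value just below.\<close>

lemma expectation_preperiod_period:
  fixes f :: "nat \<Rightarrow> nat \<Rightarrow> real"
  assumes T: "T \<ge> 1"
  shows "expectation (\<lambda>\<omega>. f (preperiod (\<lambda>t. s t \<omega>) T) (period (\<lambda>t. s t \<omega>) T)) =
    hit_mean p (f 0) T + (if odd T then f 0 T * p ^ T else 0) +
    (\<Sum>l = 1..T div 2. (1 - p) * p ^ (2 * l - 1) * passage_mean p (\<lambda>j. f l (j + l)) (T - 2 * l))"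
    (is "expectation ?X = _")
proof -
  let ?P = "\<lambda>c. prob {\<omega> \<in> space M. loop_event T c (\<lambda>t. s t \<omega>)}"
  let ?g = "\<lambda>c. f (loop_start c) (loop_length T c) * ?P c"
  have pos: "s i \<omega> > 0" if "\<omega> \<in> space M" for i \<omega>
    using letters[OF that, of i] by auto
  have "expectation ?X = (\<Sum>c\<in>loop_types T. ?g c)"
  proof (rule expectation_partition[OF finite_loop_types])
    fix c
    show "{\<omega> \<in> space M. loop_event T c (\<lambda>t. s t \<omega>)} \<in> events"
      by (cases c) simp_all
  next
    fix \<omega> assume \<omega>: "\<omega> \<in> space M"
    have "\<exists>!c. c \<in> loop_types T \<and> loop_event T c (\<lambda>t. s t \<omega>)"
      using loop_event_ex[OF T, of "\<lambda>t. s t \<omega>"] letters[OF \<omega>]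
        loop_event_in_loop_types[of T _ "\<lambda>t. s t \<omega>"]
        loop_event_unique[OF _ _ T, of _ "\<lambda>t. s t \<omega>"] pos[OF \<omega>]
      by blast
    then show "\<exists>!c. c \<in> loop_types T \<and> \<omega> \<in> {\<omega> \<in> space M. loop_event T c (\<lambda>t. s t \<omega>)}"
      using \<omega> by simp
  next
    fix c \<omega> assume "\<omega> \<in> {\<omega> \<in> space M. loop_event T c (\<lambda>t. s t \<omega>)}"
    then have "has_preperiod_period (\<lambda>t. s t \<omega>) T (loop_start c) (loop_length T c)"
      using loop_event_has_preperiod_period[OF _ T] pos by simp
    then show "?X \<omega> = f (loop_start c) (loop_length T c)"
      using preperiod_period_eqI by simp
  qed
  also have "\<dots> = (\<Sum>j\<le>T. ?g (Direct j)) + (if odd T then ?g Wrap else 0) +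
      (\<Sum>l = 1..T div 2. (\<Sum>j\<le>T - 2 * l. ?g (First l j)) +
        (if 2 * l < T then \<Sum>j\<le>T - 1 - 2 * l. ?g (Second l j) else 0))"
    by (rule sum_loop_types)
  also have "(\<Sum>j\<le>T. ?g (Direct j)) = hit_mean p (f 0) T"
    unfolding prob_loop_event_Direct by (simp add: hit_mean_def)
  also have "(if odd T then ?g Wrap else 0) = (if odd T then f 0 T * p ^ T else 0)"
    using prob_loop_event_Wrap[of T] by simp
  also have "(\<Sum>l = 1..T div 2. (\<Sum>j\<le>T - 2 * l. ?g (First l j)) +
        (if 2 * l < T then \<Sum>j\<le>T - 1 - 2 * l. ?g (Second l j) else 0)) =
      (\<Sum>l = 1..T div 2. (1 - p) * p ^ (2 * l - 1) * passage_mean p (\<lambda>j. f l (j + l)) (T - 2 * l))"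
  proof (intro sum.cong refl)
    fix l assume "l \<in> {1..T div 2}"
    then have l: "1 \<le> l" "2 * l \<le> T" by auto
    let ?q = "(1 - p) * p ^ (2 * l - 1)"
    have "(\<Sum>j\<le>T - 2 * l. ?g (First l j)) = ?q * hit_mean p (\<lambda>j. f l (j + l)) (T - 2 * l)"
      unfolding prob_loop_event_First[OF l]
      by (simp add: hit_mean_def sum_distrib_left mult_ac)
    \<comment> \<open>Compared with \<open>First l j\<close> there is one more factor
      \<open>p\<close> and one more letter: exactly the overshoot term of
      \<open>passage_mean\<close>, which is absent when \<open>2 * l = T\<close>.\<close>
    moreover have "(\<Sum>j\<le>T - 1 - 2 * l. ?g (Second l j)) =
        ?q * (p * hit_mean p (\<lambda>j. f l (Suc j + l)) (T - 2 * l - 1))" if l': "2 * l < T"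
    proof -
      have "p ^ (2 * l) = p ^ (2 * l - 1) * p"
        using l power_minus_mult[of "2 * l" p] by simp
      moreover have "2 * l + 1 \<le> T" using l' by simp
      ultimately show ?thesis
        using l by (simp add: prob_loop_event_Second hit_mean_def sum_distrib_left mult_ac
            del: loop_event.simps)
    qed
    ultimately show "(\<Sum>j\<le>T - 2 * l. ?g (First l j)) +
        (if 2 * l < T then \<Sum>j\<le>T - 1 - 2 * l. ?g (Second l j) else 0) =
      ?q * passage_mean p (\<lambda>j. f l (j + l)) (T - 2 * l)"
      by (simp add: passage_mean_def distrib_left del: loop_event.simps)
  qed
  finally show ?thesis .
qed

end

section \<open>Asymptotics\<close>

definition geometric_error :: "real \<Rightarrow> nat \<Rightarrow> (nat \<Rightarrow> real) set" where
  "geometric_error p k = O(\<lambda>T. p ^ T * real T ^ k)"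

lemma geometric_error_add:
  "f \<in> geometric_error p k \<Longrightarrow> g \<in> geometric_error p k \<Longrightarrow> (\<lambda>T. f T + g T) \<in> geometric_error p k"
  unfolding geometric_error_def by (rule sum_in_bigo)

lemma geometric_error_diff:
  "f \<in> geometric_error p k \<Longrightarrow> g \<in> geometric_error p k \<Longrightarrow> (\<lambda>T. f T - g T) \<in> geometric_error p k"
  unfolding geometric_error_def by (rule sum_in_bigo)

lemma geometric_error_cmult:
  "f \<in> geometric_error p k \<Longrightarrow> (\<lambda>T. c * f T) \<in> geometric_error p k"
  unfolding geometric_error_def by (cases "c = 0") simp_all

lemma geometric_error_mult:
  assumes "f \<in> geometric_error p k" "h \<in> O(\<lambda>T. real T)"
  shows "(\<lambda>T. h T * f T) \<in> geometric_error p (Suc k)"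
  using landau_o.big.mult[OF assms(2) assms(1)[unfolded geometric_error_def]]
  by (simp add: geometric_error_def mult_ac)

lemma geometric_error_mult_T:
  "f \<in> geometric_error p k \<Longrightarrow> (\<lambda>T. real T * f T) \<in> geometric_error p (Suc k)"
  by (erule geometric_error_mult) simp

lemma geometric_error_mult_half:
  "f \<in> geometric_error p k \<Longrightarrow> (\<lambda>T. real (T div 2) * f T) \<in> geometric_error p (Suc k)"
  by (erule geometric_error_mult) (auto intro!: landau_o.bigI[of 1])

lemma geometric_error_Suc:
  assumes "f \<in> geometric_error p k"
  shows "f \<in> geometric_error p (Suc k)"
proof -
  have "(\<lambda>T. 1 * f T) \<in> geometric_error p (Suc k)"
    using assms
    by (rule geometric_error_mult)
      (auto intro!: landau_o.bigI[of 1] eventually_mono[OF eventually_ge_at_top[of 1]])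
  then show ?thesis by simp
qed

lemma geometric_error_power_minus: "(\<lambda>T. (- p) ^ T) \<in> geometric_error p 0"
  unfolding geometric_error_def by (auto intro!: landau_o.bigI[of 1] simp: power_abs)

lemma geometric_error_odd: "(\<lambda>T. if odd T then p ^ T else 0) \<in> geometric_error p 0"
  unfolding geometric_error_def by (auto intro!: landau_o.bigI[of 1])

text \<open>\<open>2 * (T div 2)\<close> is \<open>T\<close> or \<open>T - 1\<close>, so at most one
  factor \<open>p\<close> is lost; hence the constant \<open>1 / p\<close>.\<close>

lemma geometric_error_power_half:
  assumes "0 < p" "p < 1"
  shows "(\<lambda>T. p ^ (2 * (T div 2))) \<in> geometric_error p 0"
  unfolding geometric_error_def
proof (rule landau_o.bigI[of "1 / p"])
  have "p ^ (2 * (T div 2)) * p \<le> p ^ T" for T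
  proof (cases "even T")
    case True
    then show ?thesis using assms by (simp add: mult_left_le)
  next
    case False
    then show ?thesis using power_minus_mult[of T p] by (simp add: odd_two_times_div_two_nat odd_pos)
  qed
  then show "\<forall>\<^sub>F T in at_top. norm (p ^ (2 * (T div 2))) \<le> 1 / p * norm (p ^ T * real T ^ 0)"
    using assms by (intro always_eventually) (simp add: field_simps)
qed (use assms in simp)

lemma geometric_error_product:
  assumes "f \<in> geometric_error p k" "g \<in> geometric_error p m" "0 < p" "p < 1"
  shows "(\<lambda>T. f T * g T) \<in> geometric_error p (k + m)"
proof -
  have "(\<lambda>T. f T * g T) \<in> O(\<lambda>T. (p ^ T * real T ^ k) * (p ^ T * real T ^ m))"
    using assms(1,2) unfolding geometric_error_def by (rule landau_o.big.mult)
  also have "(\<lambda>T. (p ^ T * real T ^ k) * (p ^ T * real T ^ m)) \<in> O(\<lambda>T. p ^ T * real T ^ (k + m))"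
  proof (rule landau_o.bigI[of 1])
    have "p ^ T * (p ^ T * real T ^ (k + m)) \<le> 1 * (p ^ T * real T ^ (k + m))" for T
      using assms by (intro mult_right_mono power_le_one) auto
    then show "\<forall>\<^sub>F T in at_top. norm (p ^ T * real T ^ k * (p ^ T * real T ^ m))
        \<le> 1 * norm (p ^ T * real T ^ (k + m))"
      using assms by (intro always_eventually) (simp add: power_add mult_ac)
  qed simp
  finally show ?thesis
    by (simp add: geometric_error_def)
qed

lemma geometric_error_cong:
  assumes "\<And>T. T \<ge> 1 \<Longrightarrow> f T = g T" "g \<in> geometric_error p k"
  shows "f \<in> geometric_error p k"
proof -
  have "\<forall>\<^sub>F T in at_top. f T = g T"
    using eventually_ge_at_top[of 1] by eventually_elim (rule assms(1))
  then show ?thesis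
    using assms(2) unfolding geometric_error_def by (simp add: landau_o.big.in_cong)
qed

lemmas geometric_error_intros =
  geometric_error_add geometric_error_diff geometric_error_cmult
  geometric_error_mult_T geometric_error_mult_half

text \<open>For \<open>k >= 1\<close> and \<open>L = T div 2\<close> this is the \<open>k\<close>-th
  moment of the preperiod; for \<open>k = 0\<close> it is the probability that the preperiod is
  positive.\<close>

definition start_moment :: "real \<Rightarrow> nat \<Rightarrow> nat \<Rightarrow> real" where
  "start_moment p k L = (\<Sum>l = 1..L. (1 - p) * p ^ (2 * l - 1) * real l ^ k)"

lemma start_moment_Suc:
  "start_moment p k (Suc L) = start_moment p k L + (1 - p) * (p * p ^ (2 * L)) * (real L + 1) ^ k"
  by (simp add: start_moment_def add.commute)

lemma start_moment_0:
  assumes "r * (1 + p) = 1"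
  shows "start_moment p 0 L = p * r * (1 - p ^ (2 * L))"
proof (induction L)
  case (Suc L)
  define x where "x = p ^ (2 * L)"
  have *: "p ^ (2 * Suc L) = p\<^sup>2 * x"
    by (simp add: x_def power2_eq_square)
  show ?case
    using assms unfolding start_moment_Suc Suc * x_def[symmetric] by algebra
qed (simp add: start_moment_def)

text \<open>The leading constant is the sum over all \<open>l >= 1\<close>. Shifting
  \<open>l\<close> by \<open>L\<close> in the tail gives \<open>p ^ (2 * L)\<close> times the
  binomial expansion of \<open>(l + L) ^ k\<close>, built from the limits of the moments up to
  \<open>k\<close>. The formula for \<open>k = 2\<close> arises in the same way.\<close>

lemma start_moment_1:
  assumes "r * (1 + p) = 1" "v * (1 - p) = 1"
  shows "start_moment p 1 L = p * r\<^sup>2 * v - (p * r\<^sup>2 * v + real L * (p * r)) * p ^ (2 * L)"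
proof (induction L)
  case (Suc L)
  define x where "x = p ^ (2 * L)"
  have *: "p ^ (2 * Suc L) = p\<^sup>2 * x" "real (Suc L) = real L + 1"
    by (simp_all add: x_def power2_eq_square)
  show ?case
    using assms unfolding start_moment_Suc Suc * x_def[symmetric] by algebra
qed (simp add: start_moment_def)

lemma start_moment_2:
  assumes "r * (1 + p) = 1" "v * (1 - p) = 1"
  defines "K \<equiv> p * (1 + p\<^sup>2) * r ^ 3 * v\<^sup>2"
  shows "start_moment p 2 L =
    K - (K + 2 * real L * (p * r\<^sup>2 * v) + (real L)\<^sup>2 * (p * r)) * p ^ (2 * L)"
proof (induction L)
  case (Suc L)
  define x where "x = p ^ (2 * L)"
  have *: "p ^ (2 * Suc L) = p\<^sup>2 * x" "real (Suc L) = real L + 1"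
    by (simp_all add: x_def power2_eq_square)
  show ?case
    using assms(1,2) unfolding start_moment_Suc Suc * x_def[symmetric] K_def by algebra
qed (simp add: start_moment_def)

text \<open>Since \<open>2 * l\<close> is even, the sign depends on \<open>T\<close> alone: the
  weight of \<open>l\<close> turns the oscillating part of each passage moment into a multiple of
  \<open>(- p) ^ T\<close>, which belongs to the error.\<close>

lemma power_mult_minus_power:
  fixes p :: real
  assumes "1 \<le> l" "2 * l \<le> T"
  shows "p ^ (2 * l - 1) * (- p) ^ (T - 2 * l) * p = (- p) ^ T"
proof -
  have "(- p) ^ T = (- p) ^ (2 * l + (T - 2 * l))"
    using assms by simp
  also have "\<dots> = (- p) ^ (2 * l) * (- p) ^ (T - 2 * l)"
    by (rule power_add)
  also have "(- p) ^ (2 * l) = p ^ (2 * l - 1) * p"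
    using assms power_minus_mult[of "2 * l" p] by simp
  finally show ?thesis by (simp add: mult_ac)
qed

text \<open>With offset \<open>l\<close> and level \<open>T - 2 * l\<close>, the non-oscillating
  part is a polynomial in \<open>l\<close>, so its weighted sum is a combination of
  \<open>start_moment\<close> values; the oscillating parts are equal for all
  \<open>l\<close>.\<close>

lemma sum_passage_mean_linear:
  fixes T :: nat and p r :: real
  assumes r: "r * (1 + p) = 1"
  defines "L \<equiv> T div 2"
  shows "(\<Sum>l = 1..L. (1 - p) * p ^ (2 * l - 1) * passage_mean p (\<lambda>j. real j + real l) (T - 2 * l)) =
    (1 - 2 * r) * start_moment p 1 L + (r * T + p * r\<^sup>2) * start_moment p 0 L
    - real L * ((1 - p) * r\<^sup>2 * (- p) ^ T)"
proof -
  have "(1 - p) * p ^ (2 * l - 1) * passage_mean p (\<lambda>j. real j + real l) (T - 2 * l) =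
      (1 - 2 * r) * ((1 - p) * p ^ (2 * l - 1) * real l ^ 1)
      + (r * T + p * r\<^sup>2) * ((1 - p) * p ^ (2 * l - 1) * real l ^ 0)
      - (1 - p) * r\<^sup>2 * (- p) ^ T" if "l \<in> {1..L}" for l
  proof -
    have l: "1 \<le> l" "2 * l \<le> T"
      using that by (auto simp: L_def)
    then have n: "real (T - 2 * l) = real T - 2 * real l"
      by (simp add: of_nat_diff)
    define x y where xy: "x = p ^ (2 * l - 1)" "y = (- p) ^ (T - 2 * l)"
    have z: "(- p) ^ T = x * y * p"
      unfolding xy by (rule power_mult_minus_power[OF l, symmetric])
    show ?thesis
      unfolding passage_mean_linear[OF r] n power_0 power_one_right xy[symmetric] z by algebra
  qed
  then show ?thesis
    by (simp add: start_moment_def sum.distrib sum_subtractf sum_distrib_left)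
qed

text \<open>Here \<open>b\<close> is the coefficient of \<open>n\<close> in
  \<open>passage_mean_square\<close>, and \<open>p * w\<close> is the constant called
  \<open>b\<close> there. The factor \<open>L * (L + 1)\<close> sums the terms \<open>2 * l\<close>
  left in the oscillating part.\<close>

lemma sum_passage_mean_square:
  fixes T :: nat and p r b w :: real
  assumes r: "r * (1 + p) = 1"
  defines "L \<equiv> T div 2" and "b \<equiv> r ^ 3 * p * (3 - p)" and "w \<equiv> r ^ 4 * (4 * p - 1 - p\<^sup>2)"
  shows "(\<Sum>l = 1..L. (1 - p) * p ^ (2 * l - 1) *
      passage_mean p (\<lambda>j. (real j + real l)\<^sup>2) (T - 2 * l)) =
    (1 - 2 * r)\<^sup>2 * start_moment p 2 L
    + (2 * (r - 2 * r\<^sup>2) * T + 2 * p * r\<^sup>2 - 2 * b) * start_moment p 1 L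
    + (r\<^sup>2 * (real T)\<^sup>2 + b * T + p * w) * start_moment p 0 L
    - (1 - p) * (- p) ^ T *
      ((r\<^sup>2 - 2 * p * r ^ 3) * (L * (real L + 1)) + L * (2 * p * r ^ 3 * T + w))"
proof -
  have "(1 - p) * p ^ (2 * l - 1) * passage_mean p (\<lambda>j. (real j + real l)\<^sup>2) (T - 2 * l) =
      (1 - 2 * r)\<^sup>2 * ((1 - p) * p ^ (2 * l - 1) * real l ^ 2)
      + (2 * (r - 2 * r\<^sup>2) * T + 2 * p * r\<^sup>2 - 2 * b) * ((1 - p) * p ^ (2 * l - 1) * real l ^ 1)
      + (r\<^sup>2 * (real T)\<^sup>2 + b * T + p * w) * ((1 - p) * p ^ (2 * l - 1) * real l ^ 0)
      - (1 - p) * (- p) ^ T * ((r\<^sup>2 - 2 * p * r ^ 3) * (2 * real l) + (2 * p * r ^ 3 * T + w))"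
    if "l \<in> {1..L}" for l
  proof -
    have l: "1 \<le> l" "2 * l \<le> T"
      using that by (auto simp: L_def)
    then have n: "real (T - 2 * l) = real T - 2 * real l"
      by (simp add: of_nat_diff)
    define x y where xy: "x = p ^ (2 * l - 1)" "y = (- p) ^ (T - 2 * l)"
    have z: "(- p) ^ T = x * y * p"
      unfolding xy by (rule power_mult_minus_power[OF l, symmetric])
    show ?thesis
      unfolding passage_mean_square[OF r] n power_0 power_one_right b_def w_def xy[symmetric] z by algebra
  qed
  moreover have "(\<Sum>l = 1..L. 2 * real l) = L * (real L + 1)"
    by (induction L) (simp_all add: algebra_simps)
  ultimately show ?thesis
    by (simp add: start_moment_def sum.distrib sum_subtractf flip: sum_distrib_left)
qed

section \<open>Means and variances up to geometric errors\<close>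

context letter_process
begin

abbreviation preperiod_rv :: "nat \<Rightarrow> 'a \<Rightarrow> real" where
  "preperiod_rv T \<omega> \<equiv> real (preperiod (\<lambda>t. s t \<omega>) T)"

abbreviation period_rv :: "nat \<Rightarrow> 'a \<Rightarrow> real" where
  "period_rv T \<omega> \<equiv> real (period (\<lambda>t. s t \<omega>) T)"

definition r :: real where "r = 1 / (1 + p)"

definition v :: real where "v = 1 / (1 - p)"

lemma r: "r * (1 + p) = 1" and v: "v * (1 - p) = 1"
  using p_pos p_less_1 by (simp_all add: r_def v_def)

text \<open>A power \<open>k >= 1\<close> removes the terms with preperiod \<open>0\<close>; the
  passage time then carries a constant, whose mean is itself, so only the weights of
  \<open>l\<close> remain.\<close>

lemma expectation_preperiod_power:
  assumes "T \<ge> 1" "k \<ge> 1"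
  shows "expectation (\<lambda>\<omega>. preperiod_rv T \<omega> ^ k) = start_moment p k (T div 2)"
  using expectation_preperiod_period[of T "\<lambda>l m. real l ^ k"] assms
  by (simp add: hit_mean_def passage_mean_const start_moment_def zero_power)

lemma expectation_period:
  fixes T :: nat
  assumes "T \<ge> 1"
  defines "L \<equiv> T div 2"
  shows "expectation (period_rv T) =
    r\<^sup>2 * T + r ^ 3 * p * (1 - p) + (r\<^sup>2 * p\<^sup>2 * T - r ^ 3 * p * (1 - p)) * (- p) ^ T
    + (if odd T then T * p ^ T else 0)
    + ((1 - 2 * r) * start_moment p 1 L + (r * T + p * r\<^sup>2) * start_moment p 0 L
       - real L * ((1 - p) * r\<^sup>2 * (- p) ^ T))"
  unfolding L_def
  using expectation_preperiod_period[of T "\<lambda>l m. real m"] assms(1)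
    hit_mean_linear[OF r, of 0 T] sum_passage_mean_linear[OF r, of T]
  by simp

lemma expectation_period_square:
  fixes T :: nat and b w :: real
  assumes "T \<ge> 1"
  defines "L \<equiv> T div 2" and "b \<equiv> r ^ 3 * p * (3 - p)" and "w \<equiv> r ^ 4 * (4 * p - 1 - p\<^sup>2)"
  shows "expectation (\<lambda>\<omega>. (period_rv T \<omega>)\<^sup>2) =
    r ^ 3 * (real T)\<^sup>2 + 3 * r ^ 4 * p * (1 - p) * T + r * p * (1 - p) * w
    + (r ^ 3 * p ^ 3 * (real T)\<^sup>2 - 3 * r ^ 4 * p\<^sup>2 * (1 - p) * T - r * p * (1 - p) * w) * (- p) ^ T
    + (if odd T then (real T)\<^sup>2 * p ^ T else 0)
    + ((1 - 2 * r)\<^sup>2 * start_moment p 2 L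
      + (2 * (r - 2 * r\<^sup>2) * T + 2 * p * r\<^sup>2 - 2 * b) * start_moment p 1 L
      + (r\<^sup>2 * (real T)\<^sup>2 + b * T + p * w) * start_moment p 0 L
      - (1 - p) * (- p) ^ T *
        ((r\<^sup>2 - 2 * p * r ^ 3) * (L * (real L + 1)) + L * (2 * p * r ^ 3 * T + w)))"
proof -
  have c: "r ^ 5 * p * (1 - p) * (4 * p - 1 - p\<^sup>2) = r * p * (1 - p) * w"
    unfolding w_def by algebra
  show ?thesis
    unfolding L_def b_def
    using expectation_preperiod_period[of T "\<lambda>l m. (real m)\<^sup>2"] assms(1)
      hit_mean_square[OF r, of 0 T, unfolded c] sum_passage_mean_square[OF r, of T, folded w_def]
    by simp
qed

lemma start_moment_error:
  shows "(\<lambda>T. start_moment p 0 (T div 2) - p * r) \<in> geometric_error p 0"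
    and "(\<lambda>T. start_moment p 1 (T div 2) - p * r\<^sup>2 * v) \<in> geometric_error p (Suc 0)"
    and "(\<lambda>T. start_moment p 2 (T div 2) - p * (1 + p\<^sup>2) * r ^ 3 * v\<^sup>2)
      \<in> geometric_error p (Suc (Suc 0))"
proof -
  define x where "x = (\<lambda>T. p ^ (2 * (T div 2)))"
  have x: "x \<in> geometric_error p 0"
    unfolding x_def using p_pos p_less_1 by (rule geometric_error_power_half)
  note x_intros = geometric_error_intros x geometric_error_Suc[OF x]
    geometric_error_Suc[OF geometric_error_Suc[OF x]]
  have "(\<lambda>T. - (p * r) * x T) \<in> geometric_error p 0"
    by (intro x_intros)
  then show "(\<lambda>T. start_moment p 0 (T div 2) - p * r) \<in> geometric_error p 0"
    by (rule geometric_error_cong[rotated]) (simp add: start_moment_0[OF r] x_def algebra_simps)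
  have "(\<lambda>T. - (p * r\<^sup>2 * v) * x T - (p * r) * (real (T div 2) * x T)) \<in> geometric_error p (Suc 0)"
    by (intro x_intros)
  then show "(\<lambda>T. start_moment p 1 (T div 2) - p * r\<^sup>2 * v) \<in> geometric_error p (Suc 0)"
    by (rule geometric_error_cong[rotated])
      (simp only: start_moment_1[OF r v], simp add: x_def algebra_simps)
  define K where "K = p * (1 + p\<^sup>2) * r ^ 3 * v\<^sup>2"
  have "(\<lambda>T. - K * x T - (2 * (p * r\<^sup>2 * v)) * (real (T div 2) * x T)
      - (p * r) * (real (T div 2) * (real (T div 2) * x T))) \<in> geometric_error p (Suc (Suc 0))"
    by (intro x_intros)
  then show "(\<lambda>T. start_moment p 2 (T div 2) - p * (1 + p\<^sup>2) * r ^ 3 * v\<^sup>2)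
      \<in> geometric_error p (Suc (Suc 0))"
    by (rule geometric_error_cong[rotated])
      (simp only: start_moment_2[OF r v],
        simp add: x_def K_def algebra_simps power2_eq_square)
qed

lemma expectation_preperiod_error:
  "(\<lambda>T. expectation (preperiod_rv T) - p * r\<^sup>2 * v) \<in> geometric_error p (Suc 0)"
  by (rule geometric_error_cong[OF _ start_moment_error(2)])
    (use expectation_preperiod_power[of _ 1] in simp)

lemma expectation_preperiod_square_error:
  "(\<lambda>T. expectation (\<lambda>\<omega>. (preperiod_rv T \<omega>)\<^sup>2) - p * (1 + p\<^sup>2) * r ^ 3 * v\<^sup>2)
     \<in> geometric_error p (Suc (Suc 0))"
  by (rule geometric_error_cong[OF _ start_moment_error(3)])
    (use expectation_preperiod_power[of _ 2] in simp)

lemma expectation_period_error: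
  "(\<lambda>T. expectation (period_rv T) - r * real T) \<in> geometric_error p (Suc 0)"
proof -
  define e0 where "e0 = (\<lambda>T. start_moment p 0 (T div 2) - p * r)"
  define e1 where "e1 = (\<lambda>T. start_moment p 1 (T div 2) - p * r\<^sup>2 * v)"
  define y where "y = (\<lambda>T::nat. (- p) ^ T)"
  define z where "z = (\<lambda>T::nat. if odd T then p ^ T else 0)"
  have e0: "e0 \<in> geometric_error p 0" and e1: "e1 \<in> geometric_error p (Suc 0)"
    and y: "y \<in> geometric_error p 0" and z: "z \<in> geometric_error p 0"
    unfolding e0_def e1_def y_def z_def
    using start_moment_error geometric_error_power_minus geometric_error_odd by simp_all
  have "(\<lambda>T. (r\<^sup>2 * p\<^sup>2) * (real T * y T) - (r ^ 3 * p * (1 - p)) * y T + real T * z T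
      + (1 - 2 * r) * e1 T + r * (real T * e0 T) + (p * r\<^sup>2) * e0 T
      - ((1 - p) * r\<^sup>2) * (real (T div 2) * y T)) \<in> geometric_error p (Suc 0)"
    by (intro geometric_error_intros e0 e1 y z y[THEN geometric_error_Suc] e0[THEN geometric_error_Suc])
  then show ?thesis
  proof (rule geometric_error_cong[rotated])
    fix T :: nat assume T: "T \<ge> 1"
    have E: "start_moment p 0 (T div 2) = p * r + e0 T"
      "start_moment p 1 (T div 2) = p * r\<^sup>2 * v + e1 T"
      "(if odd T then T * p ^ T else 0) = real T * z T"
      by (simp_all add: e0_def e1_def z_def)
    \<comment> \<open>From \<open>1 - 2 * r = - (1 - p) * r\<close> follows
      \<open>(1 - 2 * r) * v = - r\<close>; the terms free of \<open>T\<close> then cancel.\<close>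
    have "r\<^sup>2 * T + r ^ 3 * p * (1 - p) + (1 - 2 * r) * (p * r\<^sup>2 * v) + (r * T + p * r\<^sup>2) * (p * r)
        = r * T"
      using r v by algebra
    then show "expectation (period_rv T) - r * real T =
      (r\<^sup>2 * p\<^sup>2) * (real T * y T) - (r ^ 3 * p * (1 - p)) * y T + real T * z T
      + (1 - 2 * r) * e1 T + r * (real T * e0 T) + (p * r\<^sup>2) * e0 T
      - ((1 - p) * r\<^sup>2) * (real (T div 2) * y T)"
      unfolding expectation_period[OF T] E y_def[symmetric] fun_cong[OF y_def, symmetric] by algebra
  qed
qed

lemma expectation_period_square_error:
  "(\<lambda>T. expectation (\<lambda>\<omega>. (period_rv T \<omega>)\<^sup>2) - ((r * real T)\<^sup>2 + real T * p * (1 - p) * r ^ 3))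
     \<in> geometric_error p (Suc (Suc 0))"
proof -
  define e0 where "e0 = (\<lambda>T. start_moment p 0 (T div 2) - p * r)"
  define e1 where "e1 = (\<lambda>T. start_moment p 1 (T div 2) - p * r\<^sup>2 * v)"
  define e2 where "e2 = (\<lambda>T. start_moment p 2 (T div 2) - p * (1 + p\<^sup>2) * r ^ 3 * v\<^sup>2)"
  define y where "y = (\<lambda>T::nat. (- p) ^ T)"
  define z where "z = (\<lambda>T::nat. if odd T then p ^ T else 0)"
  define b where "b = r ^ 3 * p * (3 - p)"
  define w where "w = r ^ 4 * (4 * p - 1 - p\<^sup>2)"
  have e0: "e0 \<in> geometric_error p 0" and e1: "e1 \<in> geometric_error p (Suc 0)"
    and e2: "e2 \<in> geometric_error p (Suc (Suc 0))"
    and y: "y \<in> geometric_error p 0" and z: "z \<in> geometric_error p 0"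
    unfolding e0_def e1_def e2_def y_def z_def
    using start_moment_error geometric_error_power_minus geometric_error_odd by simp_all
  define err where "err = (\<lambda>T. (r ^ 3 * p ^ 3) * (real T * (real T * y T))
      - (3 * r ^ 4 * p\<^sup>2 * (1 - p)) * (real T * y T) - (r * p * (1 - p) * w) * y T
      + real T * (real T * z T)
      + (1 - 2 * r)\<^sup>2 * e2 T + (2 * (r - 2 * r\<^sup>2)) * (real T * e1 T)
      + (2 * p * r\<^sup>2 - 2 * b) * e1 T
      + r\<^sup>2 * (real T * (real T * e0 T)) + b * (real T * e0 T) + (p * w) * e0 T
      - ((1 - p) * (r\<^sup>2 - 2 * p * r ^ 3)) * (real (T div 2) * (real (T div 2) * y T))
      - ((1 - p) * (r\<^sup>2 - 2 * p * r ^ 3 + w)) * (real (T div 2) * y T)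
      - ((1 - p) * (2 * p * r ^ 3)) * (real T * (real (T div 2) * y T)))"
  have "err \<in> geometric_error p (Suc (Suc 0))"
    unfolding err_def
    by (intro geometric_error_intros e0 e1 e2 y z
        e0[THEN geometric_error_Suc] e0[THEN geometric_error_Suc, THEN geometric_error_Suc]
        e1[THEN geometric_error_Suc]
        y[THEN geometric_error_Suc] y[THEN geometric_error_Suc, THEN geometric_error_Suc])
  then show ?thesis
  proof (rule geometric_error_cong[rotated])
    fix T :: nat assume T: "T \<ge> 1"
    have E: "start_moment p 0 (T div 2) = p * r + e0 T"
      "start_moment p 1 (T div 2) = p * r\<^sup>2 * v + e1 T"
      "start_moment p 2 (T div 2) = p * (1 + p\<^sup>2) * r ^ 3 * v\<^sup>2 + e2 T"
      "(if odd T then (real T)\<^sup>2 * p ^ T else 0) = (real T)\<^sup>2 * z T"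
      by (simp_all add: e0_def e1_def e2_def z_def)
    \<comment> \<open>The relation \<open>(1 - 2 * r) * v = - r\<close> removes every
      \<open>v\<close> before the main terms are added up.\<close>
    have K2: "(1 - 2 * r)\<^sup>2 * (p * (1 + p\<^sup>2) * r ^ 3 * v\<^sup>2) = p * (1 + p\<^sup>2) * r ^ 5"
      using r v by algebra
    have K1: "(r - 2 * r\<^sup>2) * (p * r\<^sup>2 * v) = - p * r ^ 4"
      "(2 * p * r\<^sup>2 - 2 * b) * (p * r\<^sup>2 * v) = - 4 * p\<^sup>2 * r ^ 5"
      using r v unfolding b_def by algebra+
    have const: "r ^ 3 * (real T)\<^sup>2 + 3 * r ^ 4 * p * (1 - p) * T + r * p * (1 - p) * w
        + p * (1 + p\<^sup>2) * r ^ 5 - 2 * real T * p * r ^ 4 - 4 * p\<^sup>2 * r ^ 5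
        + (r\<^sup>2 * (real T)\<^sup>2 + b * T + p * w) * (p * r)
        = (r * real T)\<^sup>2 + real T * p * (1 - p) * r ^ 3"
      using r unfolding b_def w_def by algebra
    show "expectation (\<lambda>\<omega>. (period_rv T \<omega>)\<^sup>2) -
        ((r * real T)\<^sup>2 + real T * p * (1 - p) * r ^ 3) = err T"
      using K2 K1 const
      unfolding expectation_period_square[OF T, folded b_def w_def] E err_def
        fun_cong[OF y_def, symmetric]
      by algebra
  qed
qed

lemma integrable_power_nat_bounded:
  assumes "N \<in> measurable M (count_space UNIV)" "\<And>\<omega>. N \<omega> \<le> (T :: nat)"
  shows "integrable M (\<lambda>\<omega>. real (N \<omega>) ^ k)"
proof (rule integrable_const_bound[where B = "real T ^ k"])
  show "AE \<omega> in M. norm (real (N \<omega>) ^ k) \<le> real T ^ k"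
    using assms(2) by (intro AE_I2) (simp add: power_mono)
  show "(\<lambda>\<omega>. real (N \<omega>) ^ k) \<in> borel_measurable M"
    using assms(1) by measurable
qed

text \<open>Squaring the mean \<open>m + e\<close> contributes \<open>2 * m * e + e * e\<close>. As
  \<open>m\<close> is of order at most \<open>T\<close>, the product \<open>m * e\<close> is an
  error of order \<open>p ^ T * T ^ 2\<close>; the bound of \<open>N T\<close> by \<open>T\<close>
  provides integrability.\<close>

lemma variance_error:
  assumes N: "\<And>T. T \<ge> 1 \<Longrightarrow> N T \<in> measurable M (count_space UNIV)"
      "\<And>T \<omega>. T \<ge> 1 \<Longrightarrow> N T \<omega> \<le> T"
    and e1: "(\<lambda>T. expectation (\<lambda>\<omega>. real (N T \<omega>)) - m T) \<in> geometric_error p (Suc 0)"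
    and e2: "(\<lambda>T. expectation (\<lambda>\<omega>. (real (N T \<omega>))\<^sup>2) - ((m T)\<^sup>2 + D T))
      \<in> geometric_error p (Suc (Suc 0))"
    and m: "m \<in> O(\<lambda>T. real T)"
  shows "(\<lambda>T. variance (\<lambda>\<omega>. real (N T \<omega>)) - D T) \<in> geometric_error p (Suc (Suc 0))"
proof -
  define e where "e = (\<lambda>T. expectation (\<lambda>\<omega>. real (N T \<omega>)) - m T)"
  have "(\<lambda>T. e T * e T) \<in> geometric_error p (Suc (Suc 0))"
    using geometric_error_product[OF e1 e1 p_pos p_less_1] by (simp add: e_def)
  moreover have "(\<lambda>T. m T * e T) \<in> geometric_error p (Suc (Suc 0))"
    unfolding e_def using e1 m by (rule geometric_error_mult)
  ultimately have "(\<lambda>T. (expectation (\<lambda>\<omega>. (real (N T \<omega>))\<^sup>2) - ((m T)\<^sup>2 + D T))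
      - 2 * (m T * e T) - e T * e T) \<in> geometric_error p (Suc (Suc 0))"
    by (intro geometric_error_diff geometric_error_cmult e2)
  then show ?thesis
  proof (rule geometric_error_cong[rotated])
    fix T :: nat assume T: "T \<ge> 1"
    have V: "variance (\<lambda>\<omega>. real (N T \<omega>)) =
        expectation (\<lambda>\<omega>. (real (N T \<omega>))\<^sup>2) - (expectation (\<lambda>\<omega>. real (N T \<omega>)))\<^sup>2"
      using integrable_power_nat_bounded[OF N(1)[OF T] N(2)[OF T], of 1]
        integrable_power_nat_bounded[OF N(1)[OF T] N(2)[OF T], of 2]
      by (intro variance_eq) simp_all
    have E: "expectation (\<lambda>\<omega>. real (N T \<omega>)) = m T + e T"
      by (simp add: e_def)
    show "variance (\<lambda>\<omega>. real (N T \<omega>)) - D T =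
        (expectation (\<lambda>\<omega>. (real (N T \<omega>))\<^sup>2) - ((m T)\<^sup>2 + D T)) - 2 * (m T * e T) - e T * e T"
      unfolding V unfolding E by algebra
  qed
qed

lemma variance_preperiod_error:
  "(\<lambda>T. variance (preperiod_rv T) - (p + p ^ 3 + p ^ 4) * r ^ 4 * v\<^sup>2)
     \<in> geometric_error p (Suc (Suc 0))"
proof (rule variance_error[where m = "\<lambda>_. p * r\<^sup>2 * v"])
  have "p * (1 + p\<^sup>2) * r ^ 3 * v\<^sup>2 = (p * r\<^sup>2 * v)\<^sup>2 + (p + p ^ 3 + p ^ 4) * r ^ 4 * v\<^sup>2"
    using r by algebra
  then show "(\<lambda>T. expectation (\<lambda>\<omega>. (preperiod_rv T \<omega>)\<^sup>2) -
      ((p * r\<^sup>2 * v)\<^sup>2 + (p + p ^ 3 + p ^ 4) * r ^ 4 * v\<^sup>2)) \<in> geometric_error p (Suc (Suc 0))"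
    using expectation_preperiod_square_error by simp
  show "preperiod (\<lambda>t. s t \<omega>) T \<le> T" if "T \<ge> 1" for T \<omega>
    using preperiod_plus_period_le[OF that] by (rule add_leD1)
  have "(\<lambda>T. 1) \<in> O(\<lambda>T. real T)"
    by (auto intro!: landau_o.bigI[of 1] eventually_mono[OF eventually_ge_at_top[of 1]])
  then show "(\<lambda>T. p * r\<^sup>2 * v) \<in> O(\<lambda>T. real T)"
    by (rule landau_o.big_trans[rotated]) simp
qed (use measurable_preperiod[where s = s and M = M, OF measurable_s] expectation_preperiod_error in auto)

lemma variance_period_error:
  "(\<lambda>T. variance (period_rv T) - real T * p * (1 - p) * r ^ 3) \<in> geometric_error p (Suc (Suc 0))"
proof (rule variance_error[where m = "\<lambda>T. r * real T"])
  show "period (\<lambda>t. s t \<omega>) T \<le> T" if "T \<ge> 1" for T \<omega>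
    using preperiod_plus_period_le[OF that] by (rule add_leD2)
qed (use measurable_period[where s = s and M = M, OF measurable_s]
      expectation_period_error expectation_period_square_error in auto)

end

theorem mainTheorem1:
  fixes M :: "'a measure" and s :: "nat \<Rightarrow> 'a \<Rightarrow> nat" and p :: real
  assumes "0 < p" and "p < 1"
    and "prob_space M"
    and "prob_space.indep_vars M (\<lambda>_. count_space UNIV) s UNIV"
    and "\<And>t \<omega>. \<omega> \<in> space M \<Longrightarrow> s t \<omega> \<in> {1, 2}"
    and "\<And>t. measure M {\<omega> \<in> space M. s t \<omega> = 1} = 1 - p"
    and "\<And>t. measure M {\<omega> \<in> space M. s t \<omega> = 2} = p"
  shows
    "(\<lambda>T. prob_space.expectation M (\<lambda>\<omega>. real (preperiod (\<lambda>t. s t \<omega>) T))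
          - p / ((1 - p) * (1 + p)^2)) \<in> O[at_top](\<lambda>T::nat. p ^ T * real T) \<and>
     (\<lambda>T. prob_space.expectation M (\<lambda>\<omega>. real (period (\<lambda>t. s t \<omega>) T))
          - real T / (1 + p)) \<in> O[at_top](\<lambda>T::nat. p ^ T * real T) \<and>
     (\<lambda>T. prob_space.variance M (\<lambda>\<omega>. real (preperiod (\<lambda>t. s t \<omega>) T))
          - (p + p^3 + p^4) / ((1 - p)^2 * (1 + p)^4)) \<in> O[at_top](\<lambda>T::nat. p ^ T * (real T)^2) \<and>
     (\<lambda>T. prob_space.variance M (\<lambda>\<omega>. real (period (\<lambda>t. s t \<omega>) T))
          - real T * p * (1 - p) / (1 + p)^3) \<in> O[at_top](\<lambda>T::nat. p ^ T * (real T)^2)"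
proof -
  interpret prob_space M by fact
  interpret letter_process M s p
    using assms by unfold_locales
  have "p / ((1 - p) * (1 + p)^2) = p * r\<^sup>2 * v"
    "(p + p^3 + p^4) / ((1 - p)^2 * (1 + p)^4) = (p + p ^ 3 + p ^ 4) * r ^ 4 * v\<^sup>2"
    "real T / (1 + p) = r * real T"
    "real T * p * (1 - p) / (1 + p)^3 = real T * p * (1 - p) * r ^ 3" for T
    by (simp_all add: r_def v_def power_divide)
  then show ?thesis
    using expectation_preperiod_error expectation_period_error variance_preperiod_error
      variance_period_error
    by (simp add: geometric_error_def flip: numeral_2_eq_2)
qed

end
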